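(* Let $X$ be a reflexive Banach space such that $\|\cdot\|$ is a $\mathcal{C}^1$ functional on $X\setminus\{0\}$, and let $\Phi:X\to\mathbb{R}$ be a $\mathcal{C}^1$ functional such that $\Phi(0)=0$. Assume that there exist $p,r>1$ such that: (1) $\displaystyle\liminf_{u\to 0}\frac{\Phi'(u)u}{\|u\|^r}>0$. (2) For every $u\in X$ we have $\Phi(u)\ge C_0\|u\|^r-I(u)$, where $C_0>0$ and $I$ is a weakly continuous functional on $X$. (3) $\displaystyle\lim_{t\to\infty}\frac{\Phi(tu)}{t^p}=-\infty$ uniformly for $u$ on weakly compact subsets of $X\setminus\{0\}$. (4) For every $u\in X\setminus\{0\}$ the maps $t\mapsto\frac{\Phi'(tu)u}{t^{p-1}}$ and $t\mapsto\Phi(tu)-\frac1p\Phi'(tu)tu$ are decreasing and increasing in $(0,\infty)$, respectively. (5) The maps $u\mapsto\Phi'(u)u$ and $u\mapsto\Phi(u)-\frac1p\Phi'(u)u$ are weakly lower semicontinuous on $X$. Assume in addition that $\Phi$ is even and satisfies the Palais-Smale condition on $\mathcal{N}=\{u\in X\setminus\{0\}:\ \Phi'(u)u=0\}$. Then $\Phi$ has infinitely many pairs of critical points.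
   Context: $\Phi'(u)v$ denotes the derivative of $\Phi$ at $u$ applied to $v$. $\Phi$ is even if $\Phi(-u)=\Phi(u)$ for every $u\in X$; pairs of critical points are pairs $\{u,-u\}$. A Palais-Smale sequence of $\Phi$ is a sequence $(u_n)\subset X$ such that $(\Phi(u_n))$ is bounded and $\Phi'(u_n)\to0$ in the dual space $X'$. $\Phi$ satisfies the Palais-Smale condition on $\mathcal{N}$ if every Palais-Smale sequence of $\Phi$ which is moreover in $\mathcal{N}$ contains a convergent subsequence. "Increasing" and "decreasing" are meant strictly. A functional $I$ on $X$ is weakly continuous if $u_n\rightharpoonup u$ in $X$ implies $I(u_n)\to I(u)$.
   Formalization: The space X is additionally assumed infinite-dimensional; without this the claim fails, e.g. X = ℝ, Φ(u) = u² − u⁴ with r = 2, p = 3 meets every hypothesis but has only the critical points 0 and ±1/√2. *)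

theory Defs
  imports "HOL-Analysis.Analysis"
begin

text \<open>
  The dual space of \<open>'a\<close> is \<open>'a \<Rightarrow>\<^sub>L real\<close>. Reflexivity is surjectivity of the canonical
  embedding into the bidual.
\<close>

definition reflexive_space :: "'a::real_normed_vector itself \<Rightarrow> bool" where
  "reflexive_space _ \<longleftrightarrow>
     (\<forall>\<phi> :: ('a \<Rightarrow>\<^sub>L real) \<Rightarrow>\<^sub>L real. \<exists>x::'a. \<forall>f. blinfun_apply \<phi> f = blinfun_apply f x)"

definition infinite_dimensional :: "'a::real_vector itself \<Rightarrow> bool" where
  "infinite_dimensional _ \<longleftrightarrow> \<not> (\<exists>B::'a set. finite B \<and> span B = UNIV)"

text \<open>
  The coarsest topology making all bounded linear functionals continuous: \<open>euclidean\<close> on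
  the function space is the product topology.
\<close>

definition weak_topology :: "'a::real_normed_vector topology" where
  "weak_topology =
     pullback_topology UNIV (\<lambda>x f. blinfun_apply (f :: 'a \<Rightarrow>\<^sub>L real) x) euclidean"

definition weakly_converges :: "(nat \<Rightarrow> 'a::real_normed_vector) \<Rightarrow> 'a \<Rightarrow> bool" where
  "weakly_converges x l \<longleftrightarrow> limitin weak_topology x l sequentially"

definition weakly_continuous :: "('a::real_normed_vector \<Rightarrow> real) \<Rightarrow> bool" where
  "weakly_continuous I \<longleftrightarrow>
     (\<forall>x l. weakly_converges x l \<longrightarrow> (\<lambda>n. I (x n)) \<longlonglongrightarrow> I l)"

definition weakly_lsc :: "('a::real_normed_vector \<Rightarrow> real) \<Rightarrow> bool" where
  "weakly_lsc F \<longleftrightarrow>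
     (\<forall>x l. weakly_converges x l \<longrightarrow> ereal (F l) \<le> liminf (\<lambda>n. ereal (F (x n))))"

text \<open>The set \<open>S\<close> is meant to be open; \<open>f'\<close> is then determined on \<open>S\<close> by \<open>f\<close>.\<close>

definition C1_on ::
  "'a::real_normed_vector set \<Rightarrow> ('a \<Rightarrow> real) \<Rightarrow> ('a \<Rightarrow> 'a \<Rightarrow>\<^sub>L real) \<Rightarrow> bool" where
  "C1_on S f f' \<longleftrightarrow>
     (\<forall>x\<in>S. (f has_derivative blinfun_apply (f' x)) (at x)) \<and> continuous_on S f'"

definition nehari :: "('a::real_normed_vector \<Rightarrow> 'a \<Rightarrow>\<^sub>L real) \<Rightarrow> 'a set" where
  "nehari \<Phi>' = {u. u \<noteq> 0 \<and> blinfun_apply (\<Phi>' u) u = 0}"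

definition palais_smale_seq ::
  "('a::real_normed_vector \<Rightarrow> real) \<Rightarrow> ('a \<Rightarrow> 'a \<Rightarrow>\<^sub>L real) \<Rightarrow> (nat \<Rightarrow> 'a) \<Rightarrow> bool" where
  "palais_smale_seq \<Phi> \<Phi>' u \<longleftrightarrow>
     bounded (range (\<lambda>n. \<Phi> (u n))) \<and> (\<lambda>n. \<Phi>' (u n)) \<longlonglongrightarrow> 0"

definition palais_smale_on ::
  "'a::real_normed_vector set \<Rightarrow> ('a \<Rightarrow> real) \<Rightarrow> ('a \<Rightarrow> 'a \<Rightarrow>\<^sub>L real) \<Rightarrow> bool" where
  "palais_smale_on N \<Phi> \<Phi>' \<longleftrightarrow>
     (\<forall>u. palais_smale_seq \<Phi> \<Phi>' u \<and> (\<forall>n. u n \<in> N) \<longrightarrow>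
        (\<exists>\<sigma>::nat \<Rightarrow> nat. strict_mono \<sigma> \<and> convergent (u \<circ> \<sigma>)))"

definition critical_pairs :: "('a::real_normed_vector \<Rightarrow> 'a \<Rightarrow>\<^sub>L real) \<Rightarrow> 'a set set" where
  "critical_pairs \<Phi>' = {{u, - u} | u. \<Phi>' u = 0}"

lemma weakly_converges_iff:
  fixes x :: "nat \<Rightarrow> 'a::real_normed_vector"
  shows "weakly_converges x l \<longleftrightarrow>
    (\<forall>f :: 'a \<Rightarrow>\<^sub>L real. (\<lambda>n. blinfun_apply f (x n)) \<longlonglongrightarrow> blinfun_apply f l)"
proof -
  let ?J = "\<lambda>x f. blinfun_apply (f :: 'a \<Rightarrow>\<^sub>L real) x"
  have "weakly_converges x l \<longleftrightarrow> limitin euclidean (\<lambda>n. ?J (x n)) (?J l) sequentially"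
  proof
    assume "weakly_converges x l"
    then show "limitin euclidean (\<lambda>n. ?J (x n)) (?J l) sequentially"
      unfolding weakly_converges_def limitin_def weak_topology_def
      by (auto simp: openin_pullback_topology topspace_pullback_topology)
  next
    assume "limitin euclidean (\<lambda>n. ?J (x n)) (?J l) sequentially"
    then show "weakly_converges x l"
      unfolding weakly_converges_def limitin_def weak_topology_def
      by (auto simp: openin_pullback_topology topspace_pullback_topology)
  qed
  also have "\<dots> \<longleftrightarrow> (\<forall>f. (\<lambda>n. ?J (x n) f) \<longlonglongrightarrow> ?J l f)"
    unfolding euclidean_product_topology[symmetric]
    by (simp add: limitin_componentwise)
  finally show ?thesis .
qed

end

theory Submission
  imports Defs "HOL-Library.Z2"
begin

text \<open>
  Along every ray the map \<open>t \<mapsto> \<Phi> (t u)\<close> first increases and then decreases: its derivative is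
  positive near \<open>0\<close>, divided by \<open>t powr (p - 1)\<close> it decreases strictly, and \<open>\<Phi> (t u)\<close> is negative
  for some \<open>t > 0\<close>. So there is exactly one \<open>\<tau> u > 0\<close> with \<open>\<tau> u *\<^sub>R u\<close> on the Nehari set, and it maximises
  \<open>\<Phi>\<close> on the ray. The reduced functional \<open>\<Psi> u = \<Phi> (\<tau> u *\<^sub>R u)\<close> is even, nonnegative and constant on
  rays. Because it is a maximum over the ray it is \<open>C\<^sup>1\<close> away from \<open>0\<close>, with derivative
  \<open>\<tau> u *\<^sub>R \<Phi>' (\<tau> u *\<^sub>R u)\<close>, although \<open>\<tau>\<close> is only continuous. Hence unit vectors that are critical
  for \<open>\<Psi>\<close> correspond to critical points of \<open>\<Phi>\<close> on the Nehari set, and Palais-Smale sequences of \<open>\<Psi>\<close>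
  on the unit sphere correspond to Palais-Smale sequences of \<open>\<Phi>\<close> there.

  It remains to see that an even functional like \<open>\<Psi>\<close> on the unit sphere of an infinite dimensional
  space has infinitely many critical directions. This is Lusternik-Schnirelmann theory. The size of a
  compact symmetric set \<open>A\<close> is measured by the number \<open>j\<close> of pairs \<open>F\<^sub>i, - F\<^sub>i\<close> of disjoint
  closed sets that are needed to cover it (\<open>antipodal_cover\<close>), and the minimax levels are
  \<open>c\<^sub>j = Inf {a. some compact symmetric A on the sphere with \<Psi> \<le> a on A needs more than j pairs}\<close>.
  Two facts make the sequence \<open>c\<^sub>j\<close> a strictly increasing sequence of critical values, which contradicts
  finiteness of the set of critical directions.

  \<^item> Each \<open>c\<^sub>j\<close> is finite, because some compact symmetric subset of the sphere needs more than \<open>j\<close>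
    pairs. This is the Lusternik-Schnirelmann form of the Borsuk-Ulam theorem
    (\<open>lusternik_schnirelmann_covering\<close>). It is proved by Fan's parity argument: on a fine mod 2 chain
    that represents a hemisphere, the number of simplices with alternating labels is odd.

  \<^item> A compact symmetric set on which \<open>\<Psi> \<le> c + \<epsilon>\<close> and which stays away from the critical
    directions at level \<open>c\<close> can be moved into \<open>\<Psi> \<le> c - \<epsilon>\<close> by an odd map (\<open>deformation\<close>), for some
    \<open>\<epsilon> > 0\<close>. Since \<open>\<Psi>\<close> is only \<open>C\<^sup>1\<close>, no gradient flow is used. Ekeland's variational principle is
    applied to the space of odd displacements of the set: an almost minimal displacement whose maximum
    still exceeds \<open>c - \<epsilon>\<close> could be improved by one small step along a continuous descent field
    (\<open>descent_step\<close>). Hence \<open>c\<^sub>j\<close> is a critical value. The part of the set near finitely many critical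
    directions is covered by one more pair (\<open>sublevel_cover_critical\<close>), so \<open>c\<^sub>j < c\<^sub>j\<^sub>+\<^sub>1\<close>.
\<close>

section \<open>Mod 2 chains and alternating labels\<close>

text \<open>Sums in \<^typ>\<open>bit\<close> are rearranged as sums in a ring of characteristic two.\<close>
declare add_bit_eq_xor [simp del]

lemma bit_self_add [simp]: "(x::bit) + x = 0" "x + (x + y) = (y::bit)"
proof -
  show "x + x = 0" for x :: bit
    by (metis bit_2_eq_0 mult_2 mult_zero_left)
  then show "x + (x + y) = (y::bit)"
    by (metis add.assoc add_0)
qed

text \<open>
  Lists of points serve as ordered simplices, and lists of such lists as chains with coefficients
  in the field of two elements. Two chains that agree modulo 2 need not be equal as lists, so chains
  are only ever compared through their pairing with cochains. Accordingly the boundary \<open>\<partial> C\<close> of a chain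
  appears only through its adjoint: \<open>pairing (coboundary q) C\<close> stands for the value of \<open>q\<close> on \<open>\<partial> C\<close>,
  where \<open>coboundary q xs\<close> sums \<open>q\<close> over the lists obtained from \<open>xs\<close> by deleting one entry.
\<close>
fun coboundary :: "('v list \<Rightarrow> bit) \<Rightarrow> 'v list \<Rightarrow> bit" where
  "coboundary q [] = 0"
| "coboundary q (x # xs) = q xs + coboundary (\<lambda>ys. q (x # ys)) xs"

definition pairing :: "('v list \<Rightarrow> bit) \<Rightarrow> 'v list list \<Rightarrow> bit" where
  "pairing q C = (\<Sum>\<sigma>\<leftarrow>C. q \<sigma>)"

lemma pairing_simps [simp]:
  "pairing q [] = 0"
  "pairing q (\<sigma> # C) = q \<sigma> + pairing q C"
  "pairing q (C @ D) = pairing q C + pairing q D"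
  by (simp_all add: pairing_def)

lemma pairing_map [simp]: "pairing q (map f C) = pairing (\<lambda>\<sigma>. q (f \<sigma>)) C"
  by (simp add: pairing_def o_def)

lemma pairing_add: "pairing (\<lambda>\<sigma>. q \<sigma> + q' \<sigma>) C = pairing q C + pairing q' C"
  by (induction C) (simp_all add: ac_simps)

lemma pairing_cong:
  "(\<And>\<sigma>. \<sigma> \<in> set C \<Longrightarrow> q \<sigma> = q' \<sigma>) \<Longrightarrow> pairing q C = pairing q' C"
  by (induction C) simp_all

lemma coboundary_cong:
  "(\<And>ys. set ys \<subseteq> set xs \<Longrightarrow> q ys = q' ys) \<Longrightarrow> coboundary q xs = coboundary q' xs"
proof (induction xs arbitrary: q q')
  case (Cons x xs)
  have "coboundary (\<lambda>ys. q (x # ys)) xs = coboundary (\<lambda>ys. q' (x # ys)) xs"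
    by (rule Cons.IH, rule Cons.prems) auto
  moreover have "q xs = q' xs" by (rule Cons.prems) auto
  ultimately show ?case by simp
qed simp

lemma coboundary_add:
  "coboundary (\<lambda>\<sigma>. q \<sigma> + q' \<sigma>) xs = coboundary q xs + coboundary q' xs"
  by (induction xs arbitrary: q q') (simp_all add: ac_simps)

lemma coboundary_zero: "coboundary (\<lambda>\<sigma>. 0) xs = 0"
  by (induction xs) simp_all

lemma coboundary_map: "coboundary q (map f xs) = coboundary (\<lambda>ys. q (map f ys)) xs"
  by (induction xs arbitrary: q) simp_all

text \<open>
  The standard triangulation of the prism swept out by a simplex that moves from its image under \<open>a\<close>
  to its image under \<open>b\<close>: the simplices \<open>[a x\<^sub>0, \<dots>, a x\<^sub>i, b x\<^sub>i, \<dots>, b x\<^sub>n]\<close>.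
\<close>
fun prisms :: "('v \<Rightarrow> 'w) \<Rightarrow> ('v \<Rightarrow> 'w) \<Rightarrow> 'v list \<Rightarrow> 'w list list" where
  "prisms a b [] = []"
| "prisms a b (x # xs) = (a x # map b (x # xs)) # map ((#) (a x)) (prisms a b xs)"

text \<open>
  The chain homotopy formula. The boundary of a prism consists of its bottom, its top and the prism
  over the boundary of the simplex.
\<close>
lemma coboundary_prisms:
  "pairing (coboundary q) (prisms a b \<sigma>) + coboundary (\<lambda>\<tau>. pairing q (prisms a b \<tau>)) \<sigma>
     = q (map a \<sigma>) + q (map b \<sigma>)"
proof (induction \<sigma> arbitrary: q)
  case (Cons x xs)
  let ?q = "\<lambda>ys. q (a x # ys)"
  have IH: "pairing (coboundary ?q) (prisms a b xs) + coboundary (\<lambda>\<tau>. pairing ?q (prisms a b \<tau>)) xs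
      = q (a x # map a xs) + q (a x # map b xs)"
    using Cons.IH[of ?q] .
  have cancel: "(u + (v + w) + (m + s)) + (m + (w + z)) = u + (v + (s + z))" for u v w m s z :: bit
    by (cases u; cases v; cases w; cases m; cases s; cases z) simp_all
  have "pairing (coboundary q) (prisms a b (x # xs))
      + coboundary (\<lambda>\<tau>. pairing q (prisms a b \<tau>)) (x # xs)
    = q (map b (x # xs)) + (q (a x # map b xs) +
        (pairing (coboundary ?q) (prisms a b xs) + coboundary (\<lambda>\<tau>. pairing ?q (prisms a b \<tau>)) xs))"
    by (simp add: pairing_add coboundary_add coboundary_map cancel)
  then show ?case unfolding IH by (simp add: add.commute)
qed simp

lemma set_prisms:
  "\<tau> \<in> set (prisms a b \<sigma>) \<Longrightarrow> length \<tau> = Suc (length \<sigma>) \<and> set \<tau> \<subseteq> a ` set \<sigma> \<union> b ` set \<sigma>"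
proof (induction \<sigma> arbitrary: \<tau>)
  case (Cons x xs)
  show ?case
  proof (cases "\<tau> = a x # map b (x # xs)")
    case False
    then obtain \<rho> where "\<tau> = a x # \<rho>" "\<rho> \<in> set (prisms a b xs)"
      using Cons.prems by auto
    then show ?thesis using Cons.IH[of \<rho>] by auto
  qed auto
qed simp

text \<open>
  Deleting one entry commutes with stable sorting up to the position of the deleted entry, so the sum
  over all deletions does not notice the sorting. Inserting one element at a time reduces this to the
  case of a single insertion.
\<close>
lemma coboundary_insort:
  assumes "sorted (map f s)"
  shows "coboundary q (insort_key f x s) = q s + coboundary (\<lambda>ys. q (insort_key f x ys)) s"
  using assms
proof (induction s arbitrary: q)
  case (Cons y ys)
  show ?case
  proof (cases "f x \<le> f y")
    case True
    have "coboundary (\<lambda>ys. q (x # ys)) (y # ys) = coboundary (\<lambda>ys. q (insort_key f x ys)) (y # ys)"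
    proof (rule coboundary_cong)
      fix zs assume "set zs \<subseteq> set (y # ys)"
      then have "\<forall>z\<in>set zs. f x \<le> f z" using True Cons.prems by fastforce
      then show "q (x # zs) = q (insort_key f x zs)" by (simp add: insort_is_Cons)
    qed
    then show ?thesis using True by simp
  next
    case False
    then show ?thesis using Cons by (simp add: ac_simps)
  qed
qed simp

lemma coboundary_sort:
  "coboundary (\<lambda>ys. q (sort_key f ys)) xs = coboundary q (sort_key f xs)"
proof (induction xs arbitrary: q)
  case (Cons x xs)
  show ?case
    using Cons.IH[of "\<lambda>ys. q (insort_key f x ys)"]
    by (simp add: coboundary_insort)
qed simp

fun alternating :: "bool \<Rightarrow> bool list \<Rightarrow> bool" where
  "alternating b [] = True"
| "alternating b (s # ss) = (s = b \<and> alternating (\<not> b) ss)"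

text \<open>
  The combinatorial core of Fan's argument. From an alternating sign list exactly one deletion leaves
  a list that alternates from the prescribed sign \<open>b\<close>: the last entry has to go if the list starts with
  \<open>b\<close>, and the first one otherwise. For a list with equal neighbours the number of such deletions is 0
  or 2, because only removing one of two equal neighbours can help, and either removal gives the same list.
\<close>
lemma coboundary_alternating:
  "ss \<noteq> [] \<Longrightarrow> coboundary (\<lambda>xs. of_bool (alternating b xs)) ss
      = of_bool (alternating True ss) + of_bool (alternating False ss)"
proof (induction ss arbitrary: b)
  case (Cons s ss)
  show ?case
  proof (cases "ss = []")
    case True
    then show ?thesis by (cases s) auto
  next
    case False
    show ?thesis
      using Cons.IH[OF False, of "\<not> b"]
      by (cases s; cases b) (simp_all add: coboundary_zero add.commute)
  qed
qed simp

text \<open>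
  A point carries a label with a number and a sign. A simplex counts if the signs alternate, starting
  with \<open>b\<close>, once its points are sorted by their numbers.
\<close>
definition alt_labels :: "('v \<Rightarrow> nat) \<Rightarrow> ('v \<Rightarrow> bool) \<Rightarrow> bool \<Rightarrow> 'v list \<Rightarrow> bit" where
  "alt_labels idx sg b \<sigma> = of_bool (alternating b (map sg (sort_key idx \<sigma>)))"

lemma coboundary_alt_labels:
  assumes "\<sigma> \<noteq> []"
  shows "coboundary (alt_labels idx sg b) \<sigma> = alt_labels idx sg True \<sigma> + alt_labels idx sg False \<sigma>"
proof -
  let ?ss = "map sg (sort_key idx \<sigma>)"
  have "coboundary (alt_labels idx sg b) \<sigma> = coboundary (\<lambda>xs. of_bool (alternating b xs)) ?ss"
    unfolding alt_labels_def coboundary_map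
    by (rule coboundary_sort)
  also have "\<dots> = of_bool (alternating True ?ss) + of_bool (alternating False ?ss)"
  proof (rule coboundary_alternating)
    show "?ss \<noteq> []" using assms by (metis length_0_conv length_map length_sort)
  qed
  finally show ?thesis unfolding alt_labels_def .
qed

lemma alternating_not: "alternating b (map (\<lambda>x. \<not> sg x) xs) = alternating (\<not> b) (map sg xs)"
  by (induction xs arbitrary: b) auto

lemma sort_key_map:
  "sort_key idx (map f xs) = map f (sort_key (\<lambda>x. idx (f x)) xs)"
proof -
  have ins: "insort_key idx (f x) (map f ys) = map f (insort_key (\<lambda>x. idx (f x)) x ys)" for x ys
    by (induction ys) auto
  show ?thesis by (induction xs) (simp_all add: ins)
qed

lemma sort_key_cong': "(\<And>x. x \<in> set xs \<Longrightarrow> f x = g x) \<Longrightarrow> sort_key f xs = sort_key g xs"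
proof (induction xs)
  case (Cons x xs)
  have "insort_key f x ys = insort_key g x ys" if "set ys \<subseteq> set xs" for ys
    using that Cons.prems by (induction ys) auto
  then show ?case using Cons by simp
qed simp

lemma alt_labels_antipode:
  assumes "\<And>x. x \<in> set \<sigma> \<Longrightarrow> idx (- x) = idx x \<and> sg (- x) = (\<not> sg x)"
  shows "alt_labels idx sg b (map uminus \<sigma>) = alt_labels idx sg (\<not> b) \<sigma>"
proof -
  have "map sg (sort_key idx (map uminus \<sigma>)) = map (\<lambda>x. sg (- x)) (sort_key (\<lambda>x. idx (- x)) \<sigma>)"
    by (simp add: sort_key_map)
  also have "sort_key (\<lambda>x. idx (- x)) \<sigma> = sort_key idx \<sigma>"
    by (rule sort_key_cong') (use assms in auto)
  also have "map (\<lambda>x. sg (- x)) (sort_key idx \<sigma>) = map (\<lambda>x. \<not> sg x) (sort_key idx \<sigma>)"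
    using assms by simp
  finally show ?thesis unfolding alt_labels_def by (simp add: alternating_not)
qed

text \<open>
  If points with the same number have the same sign, two neighbours in the sorted list that share a number
  would break the alternation. So an alternating simplex uses as many numbers as it has points.
\<close>
lemma alternating_sorted_distinct:
  assumes "sorted (map idx xs)" "alternating b (map sg xs)"
    "\<And>x y. x \<in> set xs \<Longrightarrow> y \<in> set xs \<Longrightarrow> idx x = idx y \<Longrightarrow> sg x = sg y"
  shows "distinct (map idx xs)"
  using assms
proof (induction xs arbitrary: b)
  case (Cons x xs)
  have "distinct (map idx xs)" using Cons by auto
  moreover have "idx x \<notin> idx ` set xs"
  proof (cases xs)
    case (Cons y ys)
    have "sg x \<noteq> sg y" using Cons.prems(2) Cons by auto
    then have "idx x \<noteq> idx y" using Cons.prems(3)[of x y] Cons by auto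
    then show ?thesis using Cons.prems(1) Cons by fastforce
  qed simp
  ultimately show ?case by simp
qed simp

section \<open>Fine hemisphere chains\<close>

text \<open>
  Stacking the prisms between consecutive positions \<open>a k\<close> and \<open>a (Suc k)\<close> of a cycle yields a chain
  bounded by the first and the last position only: the sides vanish because \<open>Z\<close> is a cycle, and the
  intermediate layers cancel in pairs.
\<close>
lemma pairing_prism_layers:
  assumes cycle: "\<And>q. pairing (coboundary q) Z = 0"
  shows "pairing (coboundary q) (concat (map (\<lambda>k. concat (map (prisms (a k) (a (Suc k))) Z)) [0..<N]))
    = pairing q (map (map (a 0)) Z) + pairing q (map (map (a N)) Z)"
proof (induction N)
  case (Suc N)
  have layer: "pairing (coboundary q) (concat (map (prisms b c) Z))
      = pairing q (map (map b) Z) + pairing q (map (map c) Z)" for b c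
  proof -
    have "pairing (coboundary q) (concat (map (prisms b c) Z))
        = pairing (\<lambda>\<sigma>. pairing (coboundary q) (prisms b c \<sigma>)) Z"
      by (induction Z) simp_all
    also have "\<dots> = pairing (\<lambda>\<sigma>. pairing (coboundary q) (prisms b c \<sigma>)) Z
        + pairing (coboundary (\<lambda>\<tau>. pairing q (prisms b c \<tau>))) Z"
      by (simp add: cycle)
    also have "\<dots> = pairing (\<lambda>\<sigma>. q (map b \<sigma>) + q (map c \<sigma>)) Z"
      by (simp only: pairing_add[symmetric] coboundary_prisms)
    finally show ?thesis by (simp add: pairing_add)
  qed
  have cancel: "(u + v) + (v + w) = u + w" for u v w :: bit
    by (cases u; cases v; cases w) simp_all
  have "pairing (coboundary q) (concat (map (\<lambda>k. concat (map (prisms (a k) (a (Suc k))) Z)) [0..<Suc N]))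
    = pairing (coboundary q) (concat (map (\<lambda>k. concat (map (prisms (a k) (a (Suc k))) Z)) [0..<N]))
      + pairing (coboundary q) (concat (map (prisms (a N) (a (Suc N))) Z))"
    by simp
  then show ?case unfolding Suc.IH layer cancel .
qed simp

text \<open>
  \<open>C\<close> plays the role of a triangulated upper hemisphere of an \<open>n\<close>-sphere in \<open>Q\<close> with mesh below \<open>\<epsilon>\<close>.
  Together with its antipode it forms a cycle, the whole sphere. The last clause is the parity
  statement that propagates from dimension to dimension: the number of simplices with
  alternating labels is odd for every labelling such that antipodal points have the same number and
  opposite signs.
\<close>
definition hemisphere_chain :: "'a::real_normed_vector set \<Rightarrow> real \<Rightarrow> nat \<Rightarrow> 'a list list \<Rightarrow> bool" where
  "hemisphere_chain Q \<epsilon> n C \<longleftrightarrow>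
    (\<forall>\<sigma>\<in>set C. length \<sigma> = Suc n \<and> set \<sigma> \<subseteq> Q \<and> (\<forall>x\<in>set \<sigma>. \<forall>y\<in>set \<sigma>. dist x y < \<epsilon>)) \<and>
    (\<forall>q. pairing (coboundary q) (C @ map (map uminus) C) = 0) \<and>
    (\<forall>idx sg. (\<forall>x\<in>Q. idx (- x) = idx x \<and> sg (- x) = (\<not> sg x)) \<longrightarrow>
       pairing (alt_labels idx sg True) C + pairing (alt_labels idx sg False) C = 1)"

lemma hemisphere_chain_parity:
  assumes "hemisphere_chain Q \<epsilon> n C" "\<forall>x\<in>Q. idx (- x) = idx x \<and> sg (- x) = (\<not> sg x)"
  shows "pairing (alt_labels idx sg True) C + pairing (alt_labels idx sg False) C = 1"
proof -
  have "\<forall>idx sg. (\<forall>x\<in>Q. idx (- x) = idx x \<and> sg (- x) = (\<not> sg x)) \<longrightarrow>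
       pairing (alt_labels idx sg True) C + pairing (alt_labels idx sg False) C = 1"
    using assms(1) unfolding hemisphere_chain_def by (elim conjE)
  then show ?thesis using assms(2) by simp
qed

text \<open>
  The next hemisphere is the cone with apex \<open>e\<close> over the sphere \<open>C \<union> - C\<close>. To keep the mesh small
  the cone is cut into \<open>N\<close> thin layers of prisms, which increases the mesh only by \<open>R / N\<close>. At
  the apex the whole sphere collapses to one point; there the contributions of \<open>C\<close> and \<open>- C\<close>
  cancel, so the boundary of the cone is the sphere. The parity is inherited because the alternating
  simplices of the cone are counted by the coboundary, hence by its boundary \<open>C \<union> - C\<close>, and the antipodal
  map exchanges the two starting signs.
\<close>
lemma hemisphere_chain_cone:
  fixes Q :: "'a::real_normed_vector set"
  assumes C: "hemisphere_chain Q \<epsilon> n C"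
    and sym: "\<And>x. x \<in> Q \<Longrightarrow> - x \<in> Q"
    and R: "\<And>x. x \<in> Q \<Longrightarrow> norm (e - x) \<le> R"
    and Q': "\<And>x t. x \<in> Q \<Longrightarrow> 0 \<le> t \<Longrightarrow> t \<le> 1 \<Longrightarrow> x + t *\<^sub>R (e - x) \<in> Q'"
    and "\<delta> > 0"
  shows "\<exists>C'. hemisphere_chain Q' (\<epsilon> + \<delta>) (Suc n) C'"
proof -
  define Z where "Z = C @ map (map uminus) C"
  obtain N :: nat where N: "N > 0" "R / real N < \<delta>"
  proof -
    obtain N :: nat where "R / \<delta> < real N" using reals_Archimedean2 by blast
    then have "R / \<delta> < real (Suc N)" by simp
    then have "R / real (Suc N) < \<delta>" using \<open>\<delta> > 0\<close>
      by (simp add: field_simps del: of_nat_Suc)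
    then show ?thesis using that by blast
  qed
  \<comment> \<open>The position of the layer \<open>k\<close>: \<open>a 0\<close> is the identity and \<open>a N\<close> is constantly \<open>e\<close>.\<close>
  define a where "a k x = x + (real k / real N) *\<^sub>R (e - x)" for k x
  define C' where "C' = concat (map (\<lambda>k. concat (map (prisms (a k) (a (Suc k))) Z)) [0..<N])"
  have cycle: "pairing (coboundary q) Z = 0" for q
    using C unfolding hemisphere_chain_def Z_def by blast
  have Z: "length \<sigma> = Suc n" "set \<sigma> \<subseteq> Q" "\<And>x y. x \<in> set \<sigma> \<Longrightarrow> y \<in> set \<sigma> \<Longrightarrow> dist x y < \<epsilon>"
    if "\<sigma> \<in> set Z" for \<sigma>
  proof -
    obtain \<rho> where \<rho>: "\<rho> \<in> set C" "\<sigma> = \<rho> \<or> \<sigma> = map uminus \<rho>"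
      using \<open>\<sigma> \<in> set Z\<close> unfolding Z_def by auto
    have \<rho>': "length \<rho> = Suc n" "set \<rho> \<subseteq> Q" "\<And>x y. x \<in> set \<rho> \<Longrightarrow> y \<in> set \<rho> \<Longrightarrow> dist x y < \<epsilon>"
      using C \<rho>(1) unfolding hemisphere_chain_def by blast+
    show "length \<sigma> = Suc n" using \<rho>(2) \<rho>'(1) by auto
    show "set \<sigma> \<subseteq> Q" using \<rho>(2) \<rho>'(2) sym by (force simp: subset_iff)
    show "dist x y < \<epsilon>" if "x \<in> set \<sigma>" "y \<in> set \<sigma>" for x y
      using \<rho>(2) \<rho>'(3) that by (auto simp: dist_minus)
  qed
  have bd: "pairing (coboundary q) C' = pairing q Z" for q
  proof -
    have "a N = (\<lambda>_. e)" using N by (auto simp: a_def)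
    moreover have "a 0 = id" by (auto simp: a_def)
    ultimately have "pairing (coboundary q) C' = pairing q Z + pairing q (map (map (\<lambda>_. e)) Z)"
      unfolding C'_def using pairing_prism_layers[OF cycle, of q a N] by simp
    also have "pairing q (map (map (\<lambda>_. e)) Z) = 0"
      unfolding Z_def by (simp add: o_def)
    finally show ?thesis by simp
  qed
  have mesh: "length \<tau> = Suc (Suc n) \<and> set \<tau> \<subseteq> Q' \<and> (\<forall>x\<in>set \<tau>. \<forall>y\<in>set \<tau>. dist x y < \<epsilon> + \<delta>)"
    if "\<tau> \<in> set C'" for \<tau>
  proof -
    obtain k \<sigma> where k: "k < N" "\<sigma> \<in> set Z" "\<tau> \<in> set (prisms (a k) (a (Suc k)) \<sigma>)"
      using \<open>\<tau> \<in> set C'\<close> unfolding C'_def by auto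
    note P = set_prisms[OF k(3)]
    have inQ': "a i x \<in> Q'" if "i \<le> N" "x \<in> Q" for i x
      unfolding a_def using that N by (intro Q') auto
    have same: "dist (a i x) (a i y) \<le> dist x y" if "i \<le> N" for i x y
    proof -
      have "a i x - a i y = (1 - real i / real N) *\<^sub>R (x - y)"
        by (simp add: a_def algebra_simps)
      then have "dist (a i x) (a i y) = \<bar>1 - real i / real N\<bar> * dist x y"
        by (simp add: dist_norm)
      also have "\<dots> \<le> 1 * dist x y" using that N by (intro mult_right_mono) auto
      finally show ?thesis by simp
    qed
    have step: "dist (a k y) (a (Suc k) y) < \<delta>" if "y \<in> Q" for y
    proof -
      have "a (Suc k) y - a k y = (1 / real N) *\<^sub>R (e - y)"
        by (simp add: a_def algebra_simps add_divide_distrib)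
      then have "dist (a k y) (a (Suc k) y) = norm ((1 / real N) *\<^sub>R (e - y))"
        by (metis dist_commute dist_norm)
      also have "\<dots> = norm (e - y) / real N" by simp
      also have "\<dots> \<le> R / real N" using R[OF that] by (simp add: divide_right_mono)
      finally show ?thesis using N by simp
    qed
    have cross: "dist (a k x) (a (Suc k) y) < \<epsilon> + \<delta>" if "x \<in> set \<sigma>" "y \<in> set \<sigma>" for x y
    proof -
      have "dist (a k x) (a (Suc k) y) \<le> dist (a k x) (a k y) + dist (a k y) (a (Suc k) y)"
        by (rule dist_triangle)
      also have "\<dots> < \<epsilon> + \<delta>"
        using same[of k x y] Z(3)[OF k(2) that] step[of y] Z(2)[OF k(2)] that k(1)
        by (intro add_strict_mono) auto
      finally show ?thesis .
    qed
    have "dist u v < \<epsilon> + \<delta>" if "u \<in> set \<tau>" "v \<in> set \<tau>" for u v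
    proof -
      have level: "dist (a i x) (a i y) < \<epsilon> + \<delta>" if "i \<le> N" "x \<in> set \<sigma>" "y \<in> set \<sigma>" for i x y
        using same[OF that(1), of x y] Z(3)[OF k(2) that(2,3)] \<open>\<delta> > 0\<close> by linarith
      from that P have "u \<in> a k ` set \<sigma> \<union> a (Suc k) ` set \<sigma>" "v \<in> a k ` set \<sigma> \<union> a (Suc k) ` set \<sigma>"
        by auto
      then show ?thesis
        using level[of k] level[of "Suc k"] cross k(1) by (auto simp: dist_commute)
    qed
    moreover have "set \<tau> \<subseteq> Q'" using P inQ'[of k] inQ'[of "Suc k"] Z(2)[OF k(2)] k(1) by fastforce
    ultimately show ?thesis using P Z(1)[OF k(2)] by auto
  qed
  have "hemisphere_chain Q' (\<epsilon> + \<delta>) (Suc n) C'"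
    unfolding hemisphere_chain_def
  proof (intro conjI allI impI)
    show "\<forall>\<tau>\<in>set C'. length \<tau> = Suc (Suc n) \<and> set \<tau> \<subseteq> Q' \<and>
        (\<forall>x\<in>set \<tau>. \<forall>y\<in>set \<tau>. dist x y < \<epsilon> + \<delta>)"
      using mesh by blast
  next
    fix q
    have "pairing (coboundary q) (C' @ map (map uminus) C')
        = pairing (coboundary q) C' + pairing (coboundary (\<lambda>\<sigma>. q (map uminus \<sigma>))) C'"
      by (simp add: coboundary_map)
    also have "\<dots> = pairing q Z + pairing (\<lambda>\<sigma>. q (map uminus \<sigma>)) Z"
      by (simp add: bd)
    also have "\<dots> = 0" unfolding Z_def by (simp add: o_def ac_simps)
    finally show "pairing (coboundary q) (C' @ map (map uminus) C') = 0" .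
  next
    fix idx :: "'a \<Rightarrow> nat" and sg
    assume "\<forall>x\<in>Q'. idx (- x) = idx x \<and> sg (- x) = (\<not> sg x)"
    then have odd: "\<And>x. x \<in> Q \<Longrightarrow> idx (- x) = idx x \<and> sg (- x) = (\<not> sg x)"
      using Q'[of _ 0] by auto
    have "pairing (alt_labels idx sg True) C' + pairing (alt_labels idx sg False) C'
        = pairing (coboundary (alt_labels idx sg True)) C'"
    proof -
      have "\<sigma> \<noteq> []" if "\<sigma> \<in> set C'" for \<sigma> using mesh[OF that] by auto
      then have "pairing (coboundary (alt_labels idx sg True)) C'
          = pairing (\<lambda>\<sigma>. alt_labels idx sg True \<sigma> + alt_labels idx sg False \<sigma>) C'"
        by (intro pairing_cong coboundary_alt_labels)
      then show ?thesis by (simp add: pairing_add)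
    qed
    also have "\<dots> = pairing (alt_labels idx sg True) Z" by (rule bd)
    also have "\<dots> = pairing (alt_labels idx sg True) C
        + pairing (\<lambda>\<sigma>. alt_labels idx sg True (map uminus \<sigma>)) C"
      unfolding Z_def by simp
    also have "pairing (\<lambda>\<sigma>. alt_labels idx sg True (map uminus \<sigma>)) C
        = pairing (alt_labels idx sg False) C"
    proof (rule pairing_cong)
      fix \<sigma> assume "\<sigma> \<in> set C"
      then have "set \<sigma> \<subseteq> Q" using C unfolding hemisphere_chain_def by blast
      then show "alt_labels idx sg True (map uminus \<sigma>) = alt_labels idx sg False \<sigma>"
        using alt_labels_antipode[of \<sigma> idx sg True] odd by auto
    qed
    also have "pairing (alt_labels idx sg True) C + pairing (alt_labels idx sg False) C = 1"
      using hemisphere_chain_parity[OF C] odd by simp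
    finally show "pairing (alt_labels idx sg True) C' + pairing (alt_labels idx sg False) C' = 1" .
  qed
  then show ?thesis by blast
qed

lemma infinite_dimensional_new_direction:
  assumes "infinite_dimensional TYPE('a::real_normed_vector)" "finite (B::'a set)"
  obtains e where "e \<notin> span B"
  using assms unfolding infinite_dimensional_def by blast

text \<open>
  The set \<open>Q\<close> is the boundary of a cross-polytope with \<open>n + 1\<close> linearly independent axes, built as an
  iterated suspension. Working in a fixed compact set without \<open>0\<close>, while the mesh \<open>\<epsilon>\<close> is arbitrary,
  is what makes the chains useful for covers of \<open>Q\<close>.
\<close>
lemma fine_hemisphere_chains:
  assumes "infinite_dimensional TYPE('a::real_normed_vector)"
  shows "\<exists>(Q::'a set) B. compact Q \<and> (\<forall>x\<in>Q. - x \<in> Q) \<and> 0 \<notin> Q \<and> finite B \<and> Q \<subseteq> span B \<and>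
    (\<forall>\<epsilon>>0. \<exists>C. hemisphere_chain Q \<epsilon> n C)"
proof (induction n)
  case 0
  obtain e :: 'a where "e \<notin> span {}"
    using infinite_dimensional_new_direction[OF assms, of "{}"] by blast
  then have "e \<noteq> 0" by simp
  let ?Q = "{e, - e}"
  have "hemisphere_chain ?Q \<epsilon> 0 [[e]]" if "\<epsilon> > 0" for \<epsilon>
  proof -
    have "alt_labels idx sg True [e] + alt_labels idx sg False [e] = 1" for idx sg
      unfolding alt_labels_def by (cases "sg e") simp_all
    then show ?thesis unfolding hemisphere_chain_def using that by simp
  qed
  then have "compact ?Q \<and> (\<forall>x\<in>?Q. - x \<in> ?Q) \<and> 0 \<notin> ?Q \<and> finite {e} \<and> ?Q \<subseteq> span {e} \<and>
      (\<forall>\<epsilon>>0. \<exists>C. hemisphere_chain ?Q \<epsilon> 0 C)"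
    using \<open>e \<noteq> 0\<close> by (auto simp: span_base span_neg)
  then show ?case by blast
next
  case (Suc n)
  then obtain Q :: "'a set" and B where Q: "compact Q" "\<And>x. x \<in> Q \<Longrightarrow> - x \<in> Q" "0 \<notin> Q"
    "finite B" "Q \<subseteq> span B" "\<And>\<epsilon>. \<epsilon> > 0 \<Longrightarrow> \<exists>C. hemisphere_chain Q \<epsilon> n C"
    by blast
  obtain e :: 'a where e: "e \<notin> span B"
    using infinite_dimensional_new_direction[OF assms Q(4)] by blast
  define Q' where "Q' = (\<lambda>(x, t, s). (1 - t) *\<^sub>R x + (t * s) *\<^sub>R e) ` (Q \<times> {0..1::real} \<times> {1, - 1})"
  have Q'I: "(1 - t) *\<^sub>R x + (t * s) *\<^sub>R e \<in> Q'"
    if "x \<in> Q" "0 \<le> t" "t \<le> 1" "s = 1 \<or> s = - 1" for x t s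
    unfolding Q'_def using that by (intro image_eqI[where x = "(x, t, s)"]) auto
  have Q'E: "\<exists>x t s. x \<in> Q \<and> 0 \<le> t \<and> t \<le> 1 \<and> (s = 1 \<or> s = - 1) \<and>
      y = (1 - t) *\<^sub>R x + (t * s) *\<^sub>R e" if "y \<in> Q'" for y
  proof -
    from that obtain z where z: "z \<in> Q \<times> {0..1} \<times> {1, - 1}"
      "y = (case z of (x, t, s) \<Rightarrow> (1 - t) *\<^sub>R x + (t * s) *\<^sub>R e)"
      unfolding Q'_def by blast
    show ?thesis
      using z by (intro exI[of _ "fst z"] exI[of _ "fst (snd z)"] exI[of _ "snd (snd z)"])
        (simp add: case_prod_unfold mem_Times_iff)
  qed
  have "compact Q'"
    unfolding Q'_def
    by (intro compact_continuous_image compact_Times Q(1))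
       (auto intro!: continuous_intros simp: case_prod_unfold)
  moreover have "\<forall>y\<in>Q'. - y \<in> Q'"
  proof
    fix y assume "y \<in> Q'"
    then obtain x t s where y: "x \<in> Q" "0 \<le> t" "t \<le> 1" "s = 1 \<or> s = - 1"
      "y = (1 - t) *\<^sub>R x + (t * s) *\<^sub>R e"
      using Q'E by metis
    have "- y = (1 - t) *\<^sub>R (- x) + (t * (- s)) *\<^sub>R e" using y(5) by simp
    then show "- y \<in> Q'" using Q'I[of "- x" t "- s"] Q(2) y by auto
  qed
  moreover have "0 \<notin> Q'"
  proof
    assume "0 \<in> Q'"
    then obtain x t s where y: "x \<in> Q" "0 \<le> t" "t \<le> 1" "s = 1 \<or> s = - 1"
      "0 = (1 - t) *\<^sub>R x + (t * s) *\<^sub>R e"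
      using Q'E by metis
    show False
    proof (cases "t = 0")
      case True
      then show ?thesis using y Q(3) by auto
    next
      case False
      then have "t * s \<noteq> 0" using y by auto
      have "(t * s) *\<^sub>R e = - ((1 - t) *\<^sub>R x)" using y(5) by (metis add_eq_0_iff)
      then have "(t * s) *\<^sub>R e \<in> span B" using Q(5) y(1) by (auto intro: span_neg span_scale)
      then have "(1 / (t * s)) *\<^sub>R (t * s) *\<^sub>R e \<in> span B" by (rule span_scale)
      then have "e \<in> span B" using \<open>t * s \<noteq> 0\<close> by simp
      then show ?thesis using e by simp
    qed
  qed
  moreover have "Q' \<subseteq> span (insert e B)"
  proof
    fix y assume "y \<in> Q'"
    then obtain x t s where "x \<in> Q" "y = (1 - t) *\<^sub>R x + (t * s) *\<^sub>R e"
      using Q'E by metis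
    moreover have "x \<in> span (insert e B)" if "x \<in> Q" for x
      using that Q(5) span_mono[of B "insert e B"] by auto
    ultimately show "y \<in> span (insert e B)"
      by (auto intro: span_add span_scale span_base)
  qed
  moreover have "\<exists>C. hemisphere_chain Q' \<epsilon> (Suc n) C" if "\<epsilon> > 0" for \<epsilon>
  proof -
    obtain C where C: "hemisphere_chain Q (\<epsilon> / 2) n C" using Q(6)[of "\<epsilon> / 2"] \<open>\<epsilon> > 0\<close> by auto
    have "compact ((\<lambda>x. e - x) ` Q)"
      by (intro compact_continuous_image continuous_intros Q(1))
    then have "bounded ((\<lambda>x. e - x) ` Q)" by (rule compact_imp_bounded)
    then obtain R where R: "\<And>x. x \<in> Q \<Longrightarrow> norm (e - x) \<le> R"
      unfolding bounded_iff by (auto simp del: norm_minus_commute)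
    have "x + t *\<^sub>R (e - x) \<in> Q'" if "x \<in> Q" "0 \<le> t" "t \<le> 1" for x t
      using Q'I[OF that, of 1] by (simp add: algebra_simps)
    from hemisphere_chain_cone[OF C Q(2) R this, of "\<epsilon> / 2"] show ?thesis
      using that by auto
  qed
  ultimately show ?case using Q(4) by (meson finite_insert)
qed

section \<open>Covers by antipode-free closed sets\<close>

text \<open>
  The inequality \<open>genus A \<le> j\<close>, expressed by covers: \<open>A\<close> is covered by \<open>j\<close> sets \<open>F i \<union> - F i\<close>
  with \<open>F i\<close> closed and disjoint from \<open>- F i\<close>.
\<close>
definition antipodal_cover :: "'a::real_normed_vector set \<Rightarrow> nat \<Rightarrow> bool" where
  "antipodal_cover A j \<longleftrightarrow>
    (\<exists>F :: nat \<Rightarrow> 'a set. (\<forall>i<j. closed (F i) \<and> (\<forall>x\<in>F i. - x \<notin> F i)) \<and>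
       (\<forall>x\<in>A. \<exists>i<j. x \<in> F i \<or> - x \<in> F i))"

lemma antipodal_coverE:
  assumes "antipodal_cover A j"
  obtains F where "\<And>i. i < j \<Longrightarrow> closed (F i)" "\<And>i x. i < j \<Longrightarrow> x \<in> F i \<Longrightarrow> - x \<notin> F i"
    "\<And>x. x \<in> A \<Longrightarrow> \<exists>i<j. x \<in> F i \<or> - x \<in> F i"
proof -
  from assms obtain F where "\<forall>i<j. closed (F i) \<and> (\<forall>x\<in>F i. - x \<notin> F i)"
    "\<forall>x\<in>A. \<exists>i<j. x \<in> F i \<or> - x \<in> F i"
    unfolding antipodal_cover_def by (elim exE conjE)
  then show ?thesis by (intro that[of F]) auto
qed

lemma antipodal_cover_pullback:
  assumes "antipodal_cover (g ` A) j" "compact A" "continuous_on A g"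
    and sym: "\<And>x. x \<in> A \<Longrightarrow> - x \<in> A \<and> g (- x) = - g x"
  shows "antipodal_cover A j"
proof -
  obtain F where F: "\<And>i. i < j \<Longrightarrow> closed (F i)" "\<And>i x. i < j \<Longrightarrow> x \<in> F i \<Longrightarrow> - x \<notin> F i"
    "\<And>y. y \<in> g ` A \<Longrightarrow> \<exists>i<j. y \<in> F i \<or> - y \<in> F i"
    using antipodal_coverE[OF assms(1)] by metis
  let ?G = "\<lambda>i. A \<inter> g -` F i"
  have "closed (?G i)" if "i < j" for i
    using continuous_closed_preimage[OF assms(3) compact_imp_closed[OF assms(2)] F(1)[OF that]] .
  moreover have "- x \<notin> ?G i" if "i < j" "x \<in> ?G i" for i x
    using that F(2) sym by auto
  moreover have "\<exists>i<j. x \<in> ?G i \<or> - x \<in> ?G i" if "x \<in> A" for x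
    using F(3)[of "g x"] sym[OF that] that by auto
  ultimately show ?thesis unfolding antipodal_cover_def by (intro exI[of _ ?G]) simp
qed

lemma antipodal_cover_insert:
  assumes "antipodal_cover B j" "closed E" "\<And>x. x \<in> E \<Longrightarrow> - x \<notin> E"
    and "\<And>x. x \<in> A \<Longrightarrow> x \<in> B \<or> x \<in> E \<or> - x \<in> E"
  shows "antipodal_cover A (Suc j)"
proof -
  obtain F where F: "\<And>i. i < j \<Longrightarrow> closed (F i)" "\<And>i x. i < j \<Longrightarrow> x \<in> F i \<Longrightarrow> - x \<notin> F i"
    "\<And>x. x \<in> B \<Longrightarrow> \<exists>i<j. x \<in> F i \<or> - x \<in> F i"
    using antipodal_coverE[OF assms(1)] by metis
  define F' where "F' i = (if i < j then F i else E)" for i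
  have "\<exists>i<Suc j. x \<in> F' i \<or> - x \<in> F' i" if "x \<in> A" for x
  proof (cases "x \<in> B")
    case True
    then obtain i where "i < j" "x \<in> F i \<or> - x \<in> F i" using F(3) by blast
    then show ?thesis by (intro exI[of _ i]) (simp add: F'_def)
  next
    case False
    then show ?thesis using assms(4)[OF that] by (intro exI[of _ j]) (simp add: F'_def)
  qed
  moreover have "closed (F' i)" "\<forall>x\<in>F' i. - x \<notin> F' i" for i
    using F(1,2)[of i] assms(2,3) unfolding F'_def by auto
  ultimately show ?thesis unfolding antipodal_cover_def by (intro exI[of _ F']) simp
qed

text \<open>
  Label a point by the first \<open>i\<close> for which it lies in \<open>F i \<union> - F i\<close> and by the side on which it lies.
  Since \<open>F i\<close> and \<open>- F i\<close> have positive distance within the compact set \<open>Q\<close>, points of a simplex of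
  small mesh that share a number share the sign. By parity some simplex with \<open>n + 1\<close> vertices
  alternates, and then its numbers are distinct, which is impossible with \<open>n\<close> numbers available.
\<close>
theorem lusternik_schnirelmann_covering:
  assumes "infinite_dimensional TYPE('a::real_normed_vector)"
  shows "\<exists>A::'a set. compact A \<and> A \<subseteq> sphere 0 1 \<and> (\<forall>x\<in>A. - x \<in> A) \<and> \<not> antipodal_cover A n"
proof -
  obtain Q :: "'a set" where Q: "compact Q" "\<And>x. x \<in> Q \<Longrightarrow> - x \<in> Q" "0 \<notin> Q"
    "\<And>\<epsilon>. \<epsilon> > 0 \<Longrightarrow> \<exists>C. hemisphere_chain Q \<epsilon> n C"
    using fine_hemisphere_chains[OF assms, of n] by blast
  have no_cover: "\<not> antipodal_cover Q n"
  proof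
    assume "antipodal_cover Q n"
    then obtain F where F: "\<And>i. i < n \<Longrightarrow> closed (F i)" "\<And>i x. i < n \<Longrightarrow> x \<in> F i \<Longrightarrow> - x \<notin> F i"
      "\<And>x. x \<in> Q \<Longrightarrow> \<exists>i<n. x \<in> F i \<or> - x \<in> F i"
      using antipodal_coverE by metis
    have "\<exists>d>0. \<forall>x\<in>Q \<inter> F i. \<forall>y\<in>uminus ` F i. d \<le> dist x y" if "i < n" for i
    proof -
      have "compact (Q \<inter> F i)" using Q(1) F(1)[OF that] by (rule compact_Int_closed)
      moreover have "closed (uminus ` F i)" using F(1)[OF that] by (rule closed_negations)
      moreover have "Q \<inter> F i \<inter> uminus ` F i = {}" using F(2)[OF that] by auto
      ultimately have "setdist (Q \<inter> F i) (uminus ` F i) > 0 \<or> Q \<inter> F i = {} \<or> uminus ` F i = {}"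
        using setdist_eq_0_compact_closed setdist_pos_le by (metis order_le_less)
      then show ?thesis
      proof
        assume "setdist (Q \<inter> F i) (uminus ` F i) > 0"
        moreover have "\<forall>x\<in>Q \<inter> F i. \<forall>y\<in>uminus ` F i. setdist (Q \<inter> F i) (uminus ` F i) \<le> dist x y"
          by (intro ballI setdist_le_dist)
        ultimately show ?thesis by (intro exI conjI)
      qed (auto intro: exI[of _ 1])
    qed
    then obtain d where d: "\<And>i. i < n \<Longrightarrow> d i > 0"
      and d': "\<And>i. i < n \<Longrightarrow> \<forall>x\<in>Q \<inter> F i. \<forall>y\<in>uminus ` F i. d i \<le> dist x y"
      by metis
    have d'': "d i \<le> dist x y" if "i < n" "x \<in> Q" "x \<in> F i" "- y \<in> F i" for i x y
    proof -
      have "y \<in> uminus ` F i" using that(4) by (rule rev_image_eqI) simp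
      then show ?thesis using d'[OF that(1)] that(2,3) by blast
    qed
    define \<epsilon> where "\<epsilon> = Min (insert 1 (d ` {..<n}))"
    have "\<epsilon> > 0" unfolding \<epsilon>_def using d by simp
    have \<epsilon>: "\<epsilon> \<le> d i" if "i < n" for i unfolding \<epsilon>_def using that by simp
    obtain C where C: "hemisphere_chain Q \<epsilon> n C" using Q(4)[OF \<open>\<epsilon> > 0\<close>] by blast
    define idx where "idx x = (LEAST i. i < n \<and> (x \<in> F i \<or> - x \<in> F i))" for x
    define sg where "sg x \<longleftrightarrow> x \<in> F (idx x)" for x
    have idx: "idx x < n" "x \<in> F (idx x) \<or> - x \<in> F (idx x)" if "x \<in> Q" for x
      using LeastI_ex[OF F(3)[OF that]] unfolding idx_def by blast+
    have idx_minus: "idx (- x) = idx x" for x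
      unfolding idx_def by (simp add: disj_commute)
    have "\<forall>x\<in>Q. idx (- x) = idx x \<and> sg (- x) = (\<not> sg x)"
      using idx F(2) idx_minus unfolding sg_def by metis
    then have "pairing (alt_labels idx sg True) C + pairing (alt_labels idx sg False) C = 1"
      by (rule hemisphere_chain_parity[OF C])
    then have "\<exists>b. pairing (alt_labels idx sg b) C \<noteq> 0" by (metis add_0 zero_neq_one)
    then obtain b where "pairing (alt_labels idx sg b) C \<noteq> 0" by blast
    then obtain \<sigma> where \<sigma>: "\<sigma> \<in> set C" "alt_labels idx sg b \<sigma> \<noteq> 0"
    proof -
      have "pairing (\<lambda>_. 0) C = (0::bit)" by (induction C) simp_all
      then have "\<not> (\<forall>\<sigma>\<in>set C. alt_labels idx sg b \<sigma> = 0)"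
        using pairing_cong[of C "alt_labels idx sg b" "\<lambda>_. 0"]
          \<open>pairing (alt_labels idx sg b) C \<noteq> 0\<close> by metis
      then show ?thesis using that by blast
    qed
    let ?xs = "sort_key idx \<sigma>"
    have len: "length \<sigma> = Suc n" and sub: "set \<sigma> \<subseteq> Q"
      and close: "\<And>x y. x \<in> set \<sigma> \<Longrightarrow> y \<in> set \<sigma> \<Longrightarrow> dist x y < \<epsilon>"
      using C \<sigma>(1) unfolding hemisphere_chain_def by auto
    have same_sign: "x \<in> F (idx y)" if "x \<in> set \<sigma>" "y \<in> set \<sigma>" "idx x = idx y" "y \<in> F (idx y)" for x y
    proof (rule ccontr)
      assume "x \<notin> F (idx y)"
      then have "- x \<in> F (idx y)" using idx(2)[of x] sub that by auto
      then have "d (idx y) \<le> dist y x" using d''[of "idx y" y x] idx(1)[of y] sub that by auto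
      then show False using close[OF that(2,1)] \<epsilon>[of "idx y"] idx(1)[of y] sub that by fastforce
    qed
    have "distinct (map idx ?xs)"
    proof (rule alternating_sorted_distinct)
      show "alternating b (map sg ?xs)" using \<sigma>(2) unfolding alt_labels_def by auto
      show "sg x = sg y" if "x \<in> set ?xs" "y \<in> set ?xs" "idx x = idx y" for x y
        using that same_sign[of x y] same_sign[of y x] unfolding sg_def by auto
    qed simp
    then have "card (set (map idx ?xs)) = length (map idx ?xs)" by (rule distinct_card)
    then have "card (idx ` set \<sigma>) = Suc n" by (simp add: len)
    moreover have "idx ` set \<sigma> \<subseteq> {..<n}" using idx(1) sub by auto
    then have "card (idx ` set \<sigma>) \<le> n" using card_mono[of "{..<n}"] by fastforce
    ultimately show False by simp
  qed
  let ?g = "\<lambda>x::'a. x /\<^sub>R norm x"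
  have cont: "continuous_on Q ?g" using Q(3) by (auto intro!: continuous_intros)
  have "compact (?g ` Q)" using cont Q(1) by (rule compact_continuous_image)
  moreover have "?g ` Q \<subseteq> sphere 0 1"
  proof clarify
    fix x assume "x \<in> Q"
    then have "x \<noteq> 0" using Q(3) by blast
    then show "x /\<^sub>R norm x \<in> sphere 0 1" by simp
  qed
  moreover have "\<forall>x\<in>?g ` Q. - x \<in> ?g ` Q"
  proof clarify
    fix x assume "x \<in> Q"
    then show "- (x /\<^sub>R norm x) \<in> ?g ` Q" using Q(2) by (intro image_eqI[where x = "- x"]) auto
  qed
  moreover have "\<not> antipodal_cover (?g ` Q) n"
    using antipodal_cover_pullback[OF _ Q(1) cont] Q(2) no_cover by auto
  ultimately show ?thesis by blast
qed

section \<open>Ekeland's principle and descent fields\<close>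

text \<open>
  For \<open>x \<in> M\<close> let \<open>S x\<close> be the set of points \<open>y\<close> with \<open>F y + k * dist x y \<le> F x\<close>. These sets are closed
  and decrease along any sequence with \<open>x\<^sub>n\<^sub>+\<^sub>1 \<in> S x\<^sub>n\<close>. Closedness comes from lower
  semicontinuity. Choosing \<open>x\<^sub>n\<^sub>+\<^sub>1\<close> almost minimal for \<open>F\<close> on \<open>S x\<^sub>n\<close>
  makes the diameters tend to \<open>0\<close>, and the unique common point has the required property.
\<close>
lemma ekeland_variational_principle:
  fixes F :: "'m::complete_space \<Rightarrow> real"
  assumes "x\<^sub>0 \<in> M" and lsc: "\<And>a. closed {x \<in> M. F x \<le> a}"
    and below: "\<And>x. x \<in> M \<Longrightarrow> b \<le> F x" and "k > 0"
  shows "\<exists>x\<in>M. F x + k * dist x\<^sub>0 x \<le> F x\<^sub>0 \<and> (\<forall>y\<in>M. F y + k * dist x y \<le> F x \<longrightarrow> y = x)"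
proof -
  define S where "S x = {y \<in> M. F y + k * dist x y \<le> F x}" for x
  have S_trans: "z \<in> S x" if "y \<in> S x" "z \<in> S y" for x y z
  proof -
    have "k * dist x z \<le> k * dist x y + k * dist y z"
      using \<open>k > 0\<close> by (simp add: distrib_left[symmetric] dist_triangle)
    then show ?thesis using that unfolding S_def by auto
  qed
  have S_refl: "x \<in> S x" if "x \<in> M" for x using that by (simp add: S_def)
  have S_limit: "y \<in> S x" if "\<And>n. Y n \<in> S x" "Y \<longlonglongrightarrow> y" for x y Y
  proof -
    have bound: "y \<in> M \<and> F y \<le> F x - k * dist x y + e" if "e > 0" for e
    proof -
      have "(\<lambda>n. k * dist x (Y n)) \<longlonglongrightarrow> k * dist x y"
        by (intro tendsto_intros \<open>Y \<longlonglongrightarrow> y\<close>)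
      then have "\<forall>\<^sub>F n in sequentially. k * dist x y - e < k * dist x (Y n)"
        by (rule order_tendstoD) (use that in simp)
      then have "\<forall>\<^sub>F n in sequentially. Y n \<in> {z \<in> M. F z \<le> F x - k * dist x y + e}"
      proof eventually_elim
        case (elim n)
        then show ?case using \<open>Y n \<in> S x\<close> unfolding S_def by simp
      qed
      then have "y \<in> {z \<in> M. F z \<le> F x - k * dist x y + e}"
        using Lim_in_closed_set[OF lsc _ sequentially_bot \<open>Y \<longlonglongrightarrow> y\<close>] by blast
      then show ?thesis by simp
    qed
    have "F y \<le> F x - k * dist x y"
      by (rule field_le_epsilon) (use bound in blast)
    then show ?thesis using bound[of 1] unfolding S_def by auto
  qed
  have pick: "\<exists>y. y \<in> S x \<and> (\<forall>z\<in>S x. F y < F z + e)" if "x \<in> M" "e > 0" for x e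
  proof -
    have bdd: "bdd_below (F ` S x)" using below unfolding S_def by (intro bdd_belowI[of _ b]) auto
    have ne: "F ` S x \<noteq> {}" using S_refl[OF that(1)] by auto
    have "Inf (F ` S x) < Inf (F ` S x) + e" using that(2) by simp
    then obtain v where "v \<in> F ` S x" "v < Inf (F ` S x) + e" using cInf_lessD[OF ne] by blast
    moreover have "Inf (F ` S x) \<le> F z" if "z \<in> S x" for z
      using that bdd by (intro cInf_lower) auto
    ultimately show ?thesis by fastforce
  qed
  have "\<exists>X. X 0 = x\<^sub>0 \<and> (\<forall>n. X n \<in> M) \<and>
      (\<forall>n. X (Suc n) \<in> S (X n) \<and> (\<forall>z\<in>S (X n). F (X (Suc n)) < F z + (1/2) ^ n))"
  proof -
    have "\<exists>X. \<forall>n. (X n \<in> M \<and> (n = 0 \<longrightarrow> X n = x\<^sub>0)) \<and>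
        (X (Suc n) \<in> S (X n) \<and> (\<forall>z\<in>S (X n). F (X (Suc n)) < F z + (1/2) ^ n))"
    proof (rule dependent_nat_choice)
      show "\<exists>x. x \<in> M \<and> (0 = (0::nat) \<longrightarrow> x = x\<^sub>0)" using assms(1) by blast
    next
      fix x and n :: nat
      assume "x \<in> M \<and> (n = 0 \<longrightarrow> x = x\<^sub>0)"
      then obtain y where "y \<in> S x" "\<forall>z\<in>S x. F y < F z + (1/2) ^ n"
        using pick[of x "(1/2) ^ n"] by auto
      moreover from this have "y \<in> M" unfolding S_def by simp
      ultimately show "\<exists>y. (y \<in> M \<and> (Suc n = 0 \<longrightarrow> y = x\<^sub>0)) \<and>
          (y \<in> S x \<and> (\<forall>z\<in>S x. F y < F z + (1/2) ^ n))" by auto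
    qed
    then show ?thesis by auto
  qed
  then obtain X where X: "X 0 = x\<^sub>0" "\<And>n. X n \<in> M" "\<And>n. X (Suc n) \<in> S (X n)"
    "\<And>n z. z \<in> S (X n) \<Longrightarrow> F (X (Suc n)) < F z + (1/2) ^ n"
    by auto
  have chain: "X m \<in> S (X n)" if "n \<le> m" for n m
    using that
  proof (induction m rule: dec_induct)
    case base
    then show ?case by (rule S_refl[OF X(2)])
  next
    case (step m)
    then show ?case using S_trans X(3) by blast
  qed
  have dist_le: "k * dist (X n) (X m) \<le> F (X n) - F (X m)" if "n \<le> m" for n m
    using chain[OF that] unfolding S_def by simp
  have "decseq (\<lambda>n. F (X n))"
  proof (rule decseq_SucI)
    fix n
    have "0 \<le> k * dist (X n) (X (Suc n))" using \<open>k > 0\<close> by simp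
    then show "F (X (Suc n)) \<le> F (X n)" using dist_le[of n "Suc n"] by linarith
  qed
  then obtain L where "(\<lambda>n. F (X n)) \<longlonglongrightarrow> L"
    by (rule decseq_convergent[where B = b]) (use below X(2) in blast)
  then have FX: "Cauchy (\<lambda>n. F (X n))" by (rule LIMSEQ_imp_Cauchy)
  have "Cauchy X"
  proof (rule metric_CauchyI)
    fix e :: real assume "e > 0"
    then obtain N where N: "\<And>m n. m \<ge> N \<Longrightarrow> n \<ge> N \<Longrightarrow> dist (F (X m)) (F (X n)) < k * e"
      using metric_CauchyD[OF FX, of "k * e"] \<open>k > 0\<close> by auto
    have *: "dist (X n) (X m) < e" if "N \<le> n" "n \<le> m" for n m
    proof -
      have "k * dist (X n) (X m) < k * e"
        using dist_le[OF that(2)] N[of n m] that unfolding dist_real_def by linarith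
      then show ?thesis using \<open>k > 0\<close> by simp
    qed
    have "dist (X m) (X n) < e" if "N \<le> m" "N \<le> n" for m n
      using *[of m n] *[of n m] that by (cases "m \<le> n") (auto simp: dist_commute)
    then show "\<exists>N. \<forall>m\<ge>N. \<forall>n\<ge>N. dist (X m) (X n) < e" by blast
  qed
  then obtain x where x: "X \<longlonglongrightarrow> x" using Cauchy_convergent convergent_def by blast
  have xS: "x \<in> S (X n)" for n
  proof (rule S_limit)
    show "(\<lambda>i. X (i + n)) \<longlonglongrightarrow> x" using x by (rule LIMSEQ_ignore_initial_segment)
    show "X (i + n) \<in> S (X n)" for i by (rule chain) simp
  qed
  have "y = x" if "y \<in> M" "F y + k * dist x y \<le> F x" for y
  proof -
    have yS: "y \<in> S (X n)" for n by (rule S_trans[OF xS]) (use that in \<open>simp add: S_def\<close>)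
    have bound: "dist (X (Suc n)) y \<le> (1/2) ^ n / k" for n
    proof -
      have "k * dist (X (Suc n)) y \<le> F (X (Suc n)) - F y"
        using yS[of "Suc n"] unfolding S_def by simp
      also have "\<dots> \<le> (1/2) ^ n" using X(4)[OF yS[of n]] by linarith
      finally show ?thesis using \<open>k > 0\<close> by (simp add: field_simps)
    qed
    have "(\<lambda>n. (1/2) ^ n / k) \<longlonglongrightarrow> 0"
      by (intro tendsto_divide_zero LIMSEQ_realpow_zero) simp_all
    then have "(\<lambda>n. dist (X (Suc n)) y) \<longlonglongrightarrow> 0"
      by (rule Lim_null_comparison[rotated]) (simp add: bound)
    then have "(\<lambda>n. X (Suc n)) \<longlonglongrightarrow> y" by (subst tendsto_dist_iff)
    then show ?thesis using LIMSEQ_Suc[OF x] by (rule LIMSEQ_unique)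
  qed
  moreover have "x \<in> M" "F x + k * dist x\<^sub>0 x \<le> F x\<^sub>0"
    using xS[of 0] X(1) unfolding S_def by auto
  ultimately show ?thesis by blast
qed

lemma blinfun_descent_direction:
  fixes G :: "'a::real_normed_vector \<Rightarrow>\<^sub>L real"
  assumes "\<eta> < norm G" "0 \<le> \<eta>"
  shows "\<exists>w. norm w \<le> 1 \<and> blinfun_apply G w < - \<eta>"
proof -
  have "\<exists>w. \<eta> * norm w < norm (blinfun_apply G w)"
    using norm_blinfun_bound[of \<eta> G] assms by (meson not_le)
  then obtain w where w: "\<eta> * norm w < \<bar>blinfun_apply G w\<bar>" by auto
  then have "w \<noteq> 0" by auto
  define s where "s = - sgn (blinfun_apply G w) / norm w"
  have "norm (s *\<^sub>R w) \<le> 1" using \<open>w \<noteq> 0\<close> by (simp add: s_def sgn_if)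
  moreover have "blinfun_apply G (s *\<^sub>R w) = - \<bar>blinfun_apply G w\<bar> / norm w"
    by (simp add: s_def blinfun.scaleR_right blinfun.minus_right sgn_if)
  moreover have "\<eta> < \<bar>blinfun_apply G w\<bar> / norm w"
    using w \<open>w \<noteq> 0\<close> by (simp add: field_simps)
  ultimately show ?thesis by (intro exI[of _ "s *\<^sub>R w"]) auto
qed

text \<open>
  A direction that is good at one point is good nearby, and good directions at a point form a convex
  set. So finitely many of them can be averaged with weights supported in small balls.
\<close>
lemma continuous_descent_field:
  fixes H :: "'a::real_normed_vector \<Rightarrow> 'a \<Rightarrow>\<^sub>L real"
  assumes D: "compact D" and H: "continuous_on D H"
    and large: "\<And>x. x \<in> D \<Longrightarrow> \<eta> < norm (H x)" and "0 \<le> \<eta>"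
  shows "\<exists>v. continuous_on UNIV v \<and> (\<forall>x. norm (v x) \<le> 1) \<and> (\<forall>x\<in>D. blinfun_apply (H x) (v x) \<le> - \<eta>)"
proof (cases "D = {}")
  case True
  then show ?thesis by (intro exI[of _ "\<lambda>_. 0"]) auto
next
  case False
  have "\<exists>w \<rho>. norm w \<le> 1 \<and> \<rho> > 0 \<and> (\<forall>y\<in>D. dist y x < \<rho> \<longrightarrow> blinfun_apply (H y) w < - \<eta>)"
    if "x \<in> D" for x
  proof -
    obtain w where w: "norm w \<le> 1" "blinfun_apply (H x) w < - \<eta>"
      using blinfun_descent_direction[OF large[OF \<open>x \<in> D\<close>] \<open>0 \<le> \<eta>\<close>] by blast
    have "continuous_on D (\<lambda>y. blinfun_apply (H y) w)"
      by (intro continuous_intros H)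
    then have "((\<lambda>y. blinfun_apply (H y) w) \<longlongrightarrow> blinfun_apply (H x) w) (at x within D)"
      using that unfolding continuous_on_def by blast
    from order_tendstoD(2)[OF this w(2)] obtain \<rho> where "\<rho> > 0"
      "\<forall>y\<in>D. y \<noteq> x \<and> dist y x < \<rho> \<longrightarrow> blinfun_apply (H y) w < - \<eta>"
      unfolding eventually_at by blast
    then show ?thesis using w by (intro exI[of _ w] exI[of _ \<rho>]) auto
  qed
  then obtain w \<rho> where w: "\<And>x. x \<in> D \<Longrightarrow> norm (w x) \<le> 1" "\<And>x. x \<in> D \<Longrightarrow> \<rho> x > 0"
    "\<And>x y. x \<in> D \<Longrightarrow> y \<in> D \<Longrightarrow> dist y x < \<rho> x \<Longrightarrow> blinfun_apply (H y) (w x) < - \<eta>"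
    by metis
  have cover: "D \<subseteq> (\<Union>x\<in>D. ball x (\<rho> x))" using w(2) by force
  obtain T where T: "T \<subseteq> D" "finite T" "D \<subseteq> (\<Union>x\<in>T. ball x (\<rho> x))"
    using compactE_image[OF D _ cover] by (metis open_ball)
  define \<phi> where "\<phi> x y = max 0 (\<rho> x - dist y x)" for x y
  define \<Sigma> where "\<Sigma> y = (\<Sum>x\<in>T. \<phi> x y)" for y
  have \<phi>_nonneg: "0 \<le> \<phi> x y" for x y by (simp add: \<phi>_def)
  have \<phi>_cont: "continuous_on U (\<phi> x)" for x U unfolding \<phi>_def by (intro continuous_intros)
  have \<Sigma>_cont: "continuous_on U \<Sigma>" for U unfolding \<Sigma>_def by (intro continuous_intros \<phi>_cont)
  have \<Sigma>_pos: "\<Sigma> y > 0" if "y \<in> D" for y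
  proof -
    obtain x where "x \<in> T" "dist x y < \<rho> x" using T(3) \<open>y \<in> D\<close> by auto
    then have "\<phi> x y > 0" by (simp add: \<phi>_def dist_commute)
    then show ?thesis unfolding \<Sigma>_def using \<open>x \<in> T\<close> T(2) \<phi>_nonneg by (intro sum_pos2)
  qed
  obtain z where z: "z \<in> D" "\<And>y. y \<in> D \<Longrightarrow> \<Sigma> z \<le> \<Sigma> y"
    using continuous_attains_inf[OF D False \<Sigma>_cont] by blast
  \<comment> \<open>The total weight \<open>\<Sigma>\<close> vanishes far from \<open>D\<close>. Replacing it by its minimum \<open>\<Sigma> z\<close> on \<open>D\<close> where it is
    smaller keeps \<open>v\<close> continuous on the whole space and changes nothing on \<open>D\<close>.\<close>
  define v where "v y = (1 / max (\<Sigma> z) (\<Sigma> y)) *\<^sub>R (\<Sum>x\<in>T. \<phi> x y *\<^sub>R w x)" for y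
  have den: "max (\<Sigma> z) (\<Sigma> y) > 0" for y using \<Sigma>_pos[OF z(1)] by simp
  have "continuous_on UNIV v"
    unfolding v_def using den by (intro continuous_intros \<phi>_cont \<Sigma>_cont) (metis less_irrefl)
  moreover have "norm (v y) \<le> 1" for y
  proof -
    have "norm (\<Sum>x\<in>T. \<phi> x y *\<^sub>R w x) \<le> (\<Sum>x\<in>T. \<phi> x y)"
    proof (rule sum_norm_le)
      fix x assume "x \<in> T"
      then show "norm (\<phi> x y *\<^sub>R w x) \<le> \<phi> x y"
        using w(1)[of x] T(1) \<phi>_nonneg[of x y] by (auto intro: mult_left_le)
    qed
    also have "\<dots> \<le> max (\<Sigma> z) (\<Sigma> y)" by (simp add: \<Sigma>_def)
    finally show ?thesis unfolding v_def using den[of y] by (simp add: field_simps)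
  qed
  moreover have "blinfun_apply (H y) (v y) \<le> - \<eta>" if "y \<in> D" for y
  proof -
    have "(\<Sum>x\<in>T. \<phi> x y * blinfun_apply (H y) (w x)) \<le> (\<Sum>x\<in>T. \<phi> x y * (- \<eta>))"
    proof (rule sum_mono)
      fix x assume "x \<in> T"
      show "\<phi> x y * blinfun_apply (H y) (w x) \<le> \<phi> x y * (- \<eta>)"
      proof (cases "dist y x < \<rho> x")
        case True
        then show ?thesis
          using w(3)[of x y] \<open>x \<in> T\<close> T(1) that \<phi>_nonneg[of x y] by (intro mult_left_mono) auto
      qed (simp add: \<phi>_def)
    qed
    also have "\<dots> = \<Sigma> y * (- \<eta>)" by (simp add: \<Sigma>_def sum_distrib_right sum_negf)
    finally have "blinfun_apply (H y) (\<Sum>x\<in>T. \<phi> x y *\<^sub>R w x) \<le> \<Sigma> y * (- \<eta>)"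
      by (simp add: blinfun.sum_right blinfun.scaleR_right)
    moreover have "max (\<Sigma> z) (\<Sigma> y) = \<Sigma> y" using z(2)[OF that] by simp
    ultimately show ?thesis
      unfolding v_def using \<Sigma>_pos[OF that] by (simp add: blinfun.scaleR_right field_simps)
  qed
  ultimately show ?thesis by blast
qed

text \<open>
  If \<open>H\<close> is odd and \<open>u\<close> is a descent field, so is \<open>- u (- x)\<close>; the mean of the two is odd.
\<close>
lemma odd_descent_field:
  fixes H :: "'a::real_normed_vector \<Rightarrow> 'a \<Rightarrow>\<^sub>L real"
  assumes D: "compact D" and H: "continuous_on D H"
    and large: "\<And>x. x \<in> D \<Longrightarrow> \<eta> < norm (H x)" and "0 \<le> \<eta>"
    and odd: "\<And>x. x \<in> D \<Longrightarrow> - x \<in> D \<and> H (- x) = - H x"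
  shows "\<exists>v. continuous_on UNIV v \<and> (\<forall>x. norm (v x) \<le> 1) \<and> (\<forall>x. v (- x) = - v x) \<and>
    (\<forall>x\<in>D. blinfun_apply (H x) (v x) \<le> - \<eta>)"
proof -
  obtain u where u: "continuous_on UNIV u" "\<And>x. norm (u x) \<le> 1"
    "\<And>x. x \<in> D \<Longrightarrow> blinfun_apply (H x) (u x) \<le> - \<eta>"
    using continuous_descent_field[OF D H large \<open>0 \<le> \<eta>\<close>] by blast
  define v where "v x = (1/2) *\<^sub>R (u x - u (- x))" for x
  have "continuous_on UNIV (\<lambda>x. u (- x))"
    by (rule continuous_on_compose2[OF u(1)]) (auto intro: continuous_intros)
  then have "continuous_on UNIV v" unfolding v_def by (intro continuous_intros u(1))
  moreover have "norm (v x) \<le> 1" for x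
    using norm_triangle_ineq4[of "u x" "u (- x)"] u(2)[of x] u(2)[of "- x"] by (simp add: v_def)
  moreover have "v (- x) = - v x" for x by (simp add: v_def scaleR_diff_right)
  moreover have "blinfun_apply (H x) (v x) \<le> - \<eta>" if "x \<in> D" for x
    using u(3)[OF that] u(3)[of "- x"] odd[OF that]
    by (simp add: v_def blinfun.scaleR_right blinfun.diff_right blinfun.minus_left)
  ultimately show ?thesis by blast
qed

section \<open>Even functionals of degree zero\<close>

lemma line_mean_value:
  fixes f :: "'a::real_normed_vector \<Rightarrow> real"
  assumes "\<And>t. 0 \<le> t \<Longrightarrow> t \<le> 1 \<Longrightarrow> (f has_derivative blinfun_apply (f' (x + t *\<^sub>R v))) (at (x + t *\<^sub>R v))"
  shows "\<exists>t\<in>{0..1}. f (x + v) - f x = blinfun_apply (f' (x + t *\<^sub>R v)) v"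
proof -
  have "((\<lambda>t. f (x + t *\<^sub>R v)) has_derivative (\<lambda>h. blinfun_apply (f' (x + t *\<^sub>R v)) (h *\<^sub>R v)))
      (at t within {0..1})" if "0 \<le> t" "t \<le> 1" for t
  proof (rule has_derivative_compose[of "\<lambda>t. x + t *\<^sub>R v" _ t "{0..1}" f, OF _ assms[OF that]])
    show "((\<lambda>t. x + t *\<^sub>R v) has_derivative (\<lambda>h. h *\<^sub>R v)) (at t within {0..1})"
      by (auto intro!: derivative_eq_intros)
  qed
  from mvt_very_simple[OF zero_le_one this] show ?thesis by simp
qed

lemma finite_antipodal_half:
  fixes K :: "'a::real_vector set"
  assumes "finite K" "0 \<notin> K"
  shows "\<exists>P. finite P \<and> K \<subseteq> P \<union> uminus ` P \<and> P \<inter> uminus ` P = {}"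
  using assms
proof (induction K)
  case empty
  then show ?case by (intro exI[of _ "{}"]) simp
next
  case (insert x K)
  then obtain P where P: "finite P" "K \<subseteq> P \<union> uminus ` P" "P \<inter> uminus ` P = {}" by auto
  show ?case
  proof (cases "x \<in> P \<union> uminus ` P")
    case True
    then show ?thesis using P by (intro exI[of _ P]) auto
  next
    case False
    have "x \<noteq> - x"
    proof
      assume "x = - x"
      then have "x + x = 0" by (metis add.right_inverse)
      then have "2 *\<^sub>R x = 0" by (simp add: scaleR_2)
      then show False using insert.prems by simp
    qed
    moreover have "- x \<notin> P" using False by (auto intro: rev_image_eqI)
    ultimately have "insert x P \<inter> uminus ` insert x P = {}" using False P(3) by auto
    then show ?thesis using P by (intro exI[of _ "insert x P"]) auto
  qed
qed

text \<open>
  A functional on the unit sphere is treated as a functional on the punctured space that is constant on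
  rays. This gives it an ordinary derivative \<open>G\<close> without any manifold structure on the sphere. The
  compactness assumption is the Palais-Smale condition on the sphere.
\<close>
locale even_homogeneous_functional =
  fixes \<Psi> :: "'a::banach \<Rightarrow> real" and G :: "'a \<Rightarrow> 'a \<Rightarrow>\<^sub>L real" and b :: real
  assumes C1: "C1_on (- {0}) \<Psi> G"
    and even: "\<Psi> (- u) = \<Psi> u"
    and homog: "s > 0 \<Longrightarrow> \<Psi> (s *\<^sub>R u) = \<Psi> u"
    and below: "u \<noteq> 0 \<Longrightarrow> b \<le> \<Psi> u"
    and PS: "\<lbrakk>\<And>n. norm (X n) = 1; (\<lambda>n. \<Psi> (X n)) \<longlonglongrightarrow> c; (\<lambda>n. G (X n)) \<longlonglongrightarrow> 0\<rbrakk>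
      \<Longrightarrow> \<exists>\<sigma> l. strict_mono \<sigma> \<and> (\<lambda>n. X (\<sigma> n)) \<longlonglongrightarrow> l"
begin

lemma deriv: "u \<noteq> 0 \<Longrightarrow> (\<Psi> has_derivative blinfun_apply (G u)) (at u)"
  using C1 unfolding C1_on_def by simp

lemma continuous_G: "continuous_on (- {0}) G"
  using C1 unfolding C1_on_def by simp

lemma continuous_\<Psi>: "continuous_on (- {0}) \<Psi>"
  using has_derivative_continuous[OF deriv] by (intro continuous_at_imp_continuous_on) simp

lemma tendsto_G:
  assumes "X \<longlonglongrightarrow> x" "x \<noteq> 0"
  shows "(\<lambda>n. G (X n)) \<longlonglongrightarrow> G x"
proof (rule isCont_tendsto_compose[OF _ assms(1)])
  show "isCont G x" using continuous_G assms(2) by (simp add: continuous_on_eq_continuous_at open_Compl)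
qed

lemma tendsto_\<Psi>:
  assumes "X \<longlonglongrightarrow> x" "x \<noteq> 0"
  shows "(\<lambda>n. \<Psi> (X n)) \<longlonglongrightarrow> \<Psi> x"
  by (rule isCont_tendsto_compose[OF has_derivative_continuous[OF deriv] assms(1)]) (rule assms(2))

text \<open>
  Invariance of \<open>\<Psi>\<close> under a dilation, including the one by \<open>-1\<close>, is differentiated.
\<close>
lemma G_scale:
  assumes "u \<noteq> 0" "s \<noteq> 0" and inv: "\<And>x. \<Psi> (s *\<^sub>R x) = \<Psi> x"
  shows "G u = s *\<^sub>R G (s *\<^sub>R u)"
proof (rule blinfun_eqI)
  fix h
  have "((\<lambda>x. \<Psi> (s *\<^sub>R x)) has_derivative (\<lambda>h. blinfun_apply (G (s *\<^sub>R u)) (s *\<^sub>R h))) (at u)"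
  proof (rule has_derivative_compose[of "\<lambda>x. s *\<^sub>R x" "\<lambda>h. s *\<^sub>R h" u UNIV \<Psi>])
    show "((\<lambda>x. s *\<^sub>R x) has_derivative (\<lambda>h. s *\<^sub>R h)) (at u)" by (auto intro!: derivative_eq_intros)
    show "(\<Psi> has_derivative blinfun_apply (G (s *\<^sub>R u))) (at (s *\<^sub>R u))" using assms by (intro deriv) simp
  qed
  then have "(\<Psi> has_derivative (\<lambda>h. blinfun_apply (G (s *\<^sub>R u)) (s *\<^sub>R h))) (at u)" by (simp add: inv)
  then have "blinfun_apply (G u) = (\<lambda>h. blinfun_apply (G (s *\<^sub>R u)) (s *\<^sub>R h))"
    using deriv[OF assms(1)] has_derivative_unique by blast
  then show "blinfun_apply (G u) h = blinfun_apply (s *\<^sub>R G (s *\<^sub>R u)) h"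
    by (simp add: blinfun.scaleR_left blinfun.scaleR_right)
qed

lemma G_odd: "u \<noteq> 0 \<Longrightarrow> G (- u) = - G u"
  using G_scale[of u "- 1"] even by simp

lemma G_homog: "u \<noteq> 0 \<Longrightarrow> s > 0 \<Longrightarrow> G u = s *\<^sub>R G (s *\<^sub>R u)"
  using G_scale[of u s] homog by simp

definition crit_dirs :: "real \<Rightarrow> 'a set" where
  "crit_dirs c = {u. norm u = 1 \<and> G u = 0 \<and> \<Psi> u = c}"

text \<open>
  Without such a gap there would be unit vectors away from \<open>crit_dirs c\<close> whose values tend to \<open>c\<close> and whose
  derivatives tend to \<open>0\<close>. By compactness they would accumulate at a critical direction at level \<open>c\<close>.
\<close>
lemma gradient_gap:
  assumes "d > 0"
  shows "\<exists>\<epsilon>>0. \<forall>u. norm u = 1 \<and> \<bar>\<Psi> u - c\<bar> \<le> \<epsilon> \<and> (\<forall>k\<in>crit_dirs c. d \<le> dist u k) \<longrightarrow> \<epsilon> \<le> norm (G u)"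
proof (rule ccontr)
  assume neg: "\<not> ?thesis"
  have "\<exists>u. norm u = 1 \<and> \<bar>\<Psi> u - c\<bar> \<le> inverse (real (Suc n)) \<and> (\<forall>k\<in>crit_dirs c. d \<le> dist u k) \<and>
      norm (G u) < inverse (real (Suc n))" for n
  proof -
    have "inverse (real (Suc n)) > 0" by simp
    then show ?thesis using neg by (meson not_le)
  qed
  then obtain u where u: "\<And>n. norm (u n) = 1" "\<And>n. \<bar>\<Psi> (u n) - c\<bar> \<le> inverse (real (Suc n))"
    "\<And>n k. k \<in> crit_dirs c \<Longrightarrow> d \<le> dist (u n) k" "\<And>n. norm (G (u n)) < inverse (real (Suc n))"
    by metis
  have "(\<lambda>n. \<Psi> (u n) - c) \<longlonglongrightarrow> 0"
    by (rule Lim_null_comparison[OF _ LIMSEQ_inverse_real_of_nat]) (use u(2) in simp)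
  then have \<Psi>: "(\<lambda>n. \<Psi> (u n)) \<longlonglongrightarrow> c" by (simp add: LIM_zero_iff)
  have G0: "(\<lambda>n. G (u n)) \<longlonglongrightarrow> 0"
    by (rule Lim_null_comparison[OF _ LIMSEQ_inverse_real_of_nat]) (use u(4) in \<open>simp add: less_imp_le\<close>)
  obtain \<sigma> l where \<sigma>: "strict_mono \<sigma>" "(\<lambda>n. u (\<sigma> n)) \<longlonglongrightarrow> l" using PS[OF u(1) \<Psi> G0] by blast
  have "(\<lambda>n. norm (u (\<sigma> n))) \<longlonglongrightarrow> norm l" by (intro tendsto_intros \<sigma>)
  then have "norm l = 1" by (simp add: u(1) LIMSEQ_const_iff)
  then have "l \<noteq> 0" by auto
  have "(\<lambda>n. \<Psi> (u (\<sigma> n))) \<longlonglongrightarrow> c" using LIMSEQ_subseq_LIMSEQ[OF \<Psi> \<sigma>(1)] by (simp add: o_def)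
  then have "\<Psi> l = c" using tendsto_\<Psi>[OF \<sigma>(2) \<open>l \<noteq> 0\<close>] LIMSEQ_unique by metis
  moreover have "(\<lambda>n. G (u (\<sigma> n))) \<longlonglongrightarrow> 0" using LIMSEQ_subseq_LIMSEQ[OF G0 \<sigma>(1)] by (simp add: o_def)
  then have "G l = 0" using tendsto_G[OF \<sigma>(2) \<open>l \<noteq> 0\<close>] LIMSEQ_unique by metis
  ultimately have "l \<in> crit_dirs c" using \<open>norm l = 1\<close> by (simp add: crit_dirs_def)
  then have "d \<le> dist (u (\<sigma> n)) l" for n by (rule u(3))
  moreover have "(\<lambda>n. dist (u (\<sigma> n)) l) \<longlonglongrightarrow> 0" using \<sigma>(2) by (subst (asm) tendsto_dist_iff)
  ultimately have "d \<le> 0" by (intro LIMSEQ_le_const) auto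
  then show False using assms by simp
qed

text \<open>
  The maps by which a compact set \<open>A\<close> is deformed are written \<open>x \<mapsto> x + f x\<close> with \<open>f\<close> bounded and
  continuous on the whole space, because these displacements form a Banach space. With \<open>norm f \<le> 1/2\<close> a
  displaced unit vector stays away from \<open>0\<close>.
\<close>
definition peak :: "'a set \<Rightarrow> ('a \<Rightarrow>\<^sub>C 'a) \<Rightarrow> real" where
  "peak A f = (SUP x\<in>A. \<Psi> (x + f x))"

lemma displaced_norm:
  assumes "norm x = 1" "norm f \<le> m"
  shows "1 - m \<le> norm (x + apply_bcontfun f x)" "norm (x + apply_bcontfun f x) \<le> 1 + m"
  using norm_triangle_ineq[of x "f x"] norm_diff_ineq[of x "f x"] norm_bounded[of f x] assms by linarith+

lemma displaced_nonzero:
  assumes "norm x = 1" "norm f \<le> 1/2"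
  shows "x + apply_bcontfun f x \<noteq> 0"
  using displaced_norm(1)[OF assms] by auto

lemma peak_attained:
  assumes "compact A" "A \<noteq> {}" "A \<subseteq> sphere 0 1" "norm f \<le> 1/2"
  shows "\<exists>x\<in>A. peak A f = \<Psi> (x + apply_bcontfun f x)"
    and "x \<in> A \<Longrightarrow> \<Psi> (x + apply_bcontfun f x) \<le> peak A f"
proof -
  have "continuous_on A (\<lambda>x. \<Psi> (x + f x))"
  proof (rule continuous_on_compose2[OF continuous_\<Psi>])
    show "continuous_on A (\<lambda>x. x + apply_bcontfun f x)" by (intro continuous_intros) auto
    show "(\<lambda>x. x + apply_bcontfun f x) ` A \<subseteq> - {0}"
      using displaced_nonzero assms(3,4) by fastforce
  qed
  then obtain x where x: "x \<in> A" "\<forall>y\<in>A. \<Psi> (y + f y) \<le> \<Psi> (x + f x)"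
    using continuous_attains_sup[OF assms(1,2)] by blast
  have "peak A f = \<Psi> (x + f x)"
    unfolding peak_def using x by (intro cSup_eq_maximum) auto
  then show "\<exists>x\<in>A. peak A f = \<Psi> (x + f x)" "x \<in> A \<Longrightarrow> \<Psi> (x + f x) \<le> peak A f" for x
    using x by auto
qed

text \<open>
  Add to \<open>f\<close> a small multiple \<open>s\<close> of an odd descent field that has slope at most \<open>- 2 k\<close> where the peak is
  attained. If the peak did not drop by more than \<open>k * s\<close> for any small \<open>s\<close>, the points at which the new
  peaks are attained would accumulate at a peak point of \<open>f\<close>, and by the mean value theorem the slope
  there would be at least \<open>- k\<close>.
\<close>
lemma descent_step:
  assumes A: "compact A" "A \<noteq> {}" "A \<subseteq> sphere 0 1" "\<And>x. x \<in> A \<Longrightarrow> - x \<in> A"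
    and f: "norm f \<le> 1/4" "\<And>x. apply_bcontfun f (- x) = - apply_bcontfun f x"
    and "k > 0"
    and steep: "\<And>x. x \<in> A \<Longrightarrow> \<Psi> (x + apply_bcontfun f x) = peak A f \<Longrightarrow> 2 * k < norm (G (x + apply_bcontfun f x))"
  shows "\<exists>h. norm h \<le> 1/2 \<and> (\<forall>x. apply_bcontfun h (- x) = - apply_bcontfun h x) \<and>
    peak A h + k * dist f h < peak A f"
proof (rule ccontr)
  assume neg: "\<not> ?thesis"
  define D where "D = {x \<in> A. \<Psi> (x + f x) = peak A f}"
  have nz: "x + f x \<noteq> 0" if "x \<in> A" for x
    using displaced_nonzero[of x f] A(3) f(1) that by auto
  have contA: "continuous_on A (\<lambda>x. x + f x)" by (intro continuous_intros) auto
  have cont\<Psi>: "continuous_on A (\<lambda>x. \<Psi> (x + f x))"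
    by (rule continuous_on_compose2[OF continuous_\<Psi> contA]) (use nz in auto)
  have contG: "continuous_on A (\<lambda>x. G (x + f x))"
    by (rule continuous_on_compose2[OF continuous_G contA]) (use nz in auto)
  have "closed (A \<inter> (\<lambda>x. \<Psi> (x + f x)) -` {peak A f})"
    by (rule continuous_closed_preimage[OF cont\<Psi> compact_imp_closed[OF A(1)]]) simp
  also have "A \<inter> (\<lambda>x. \<Psi> (x + f x)) -` {peak A f} = D" unfolding D_def by auto
  finally have "compact (A \<inter> D)" by (rule compact_Int_closed[OF A(1)])
  also have "A \<inter> D = D" unfolding D_def by auto
  finally have D: "compact D" .
  have "\<exists>v. continuous_on UNIV v \<and> (\<forall>x. norm (v x) \<le> 1) \<and> (\<forall>x. v (- x) = - v x) \<and>
    (\<forall>x\<in>D. blinfun_apply (G (x + f x)) (v x) \<le> - (2 * k))"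
  proof (rule odd_descent_field[OF D])
    show "continuous_on D (\<lambda>x. G (x + f x))" by (rule continuous_on_subset[OF contG]) (auto simp: D_def)
    show "2 * k < norm (G (x + f x))" if "x \<in> D" for x using steep that unfolding D_def by auto
    show "0 \<le> 2 * k" using \<open>k > 0\<close> by simp
    show "- x \<in> D \<and> G (- x + f (- x)) = - G (x + f x)" if "x \<in> D" for x
    proof -
      have "x \<in> A" using that by (simp add: D_def)
      have eq: "- x + f (- x) = - (x + f x)" by (simp add: f(2))
      show ?thesis unfolding D_def mem_Collect_eq eq even G_odd[OF nz[OF \<open>x \<in> A\<close>]]
        using that A(4) unfolding D_def by simp
    qed
  qed
  then obtain v where v: "continuous_on UNIV v" "\<And>x. norm (v x) \<le> 1" "\<And>x. v (- x) = - v x"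
    "\<And>x. x \<in> D \<Longrightarrow> blinfun_apply (G (x + f x)) (v x) \<le> - (2 * k)" by auto
  define V where "V = Bcontfun v"
  have V: "apply_bcontfun V = v" unfolding V_def by (rule Bcontfun_inverse) (rule bcontfun_normI[OF v(1,2)])
  have normV: "norm V \<le> 1" by (rule norm_bound) (simp add: V v(2))
  \<comment> \<open>The factor \<open>1/4\<close> keeps \<open>f + s n *\<^sub>R V\<close> in the ball of radius \<open>1/2\<close>.\<close>
  define s where "s n = inverse (real (Suc n)) / 4" for n
  have s: "0 < s n" "s n \<le> 1/4" for n unfolding s_def by (auto simp: field_simps)
  have s0: "s \<longlonglongrightarrow> 0" unfolding s_def
    by (rule tendsto_divide_zero[OF LIMSEQ_inverse_real_of_nat])
  define h where "h n = f + s n *\<^sub>R V" for n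
  have happ: "apply_bcontfun (h n) x = f x + s n *\<^sub>R v x" for n x by (simp add: h_def V)
  have sV: "norm (s n *\<^sub>R V) \<le> s n" for n
    using mult_left_mono[OF normV less_imp_le[OF s(1)[of n]]] s(1)[of n] by simp
  have hnorm: "norm (h n) \<le> 1/2" for n
    using norm_triangle_ineq[of f "s n *\<^sub>R V"] sV[of n] s(2)[of n] f(1) unfolding h_def by linarith
  have "peak A f \<le> peak A (h n) + k * s n" for n
  proof -
    have "peak A f \<le> peak A (h n) + k * dist f (h n)"
      using neg hnorm[of n] f(2) v(3) happ[of n] by (auto simp: not_less)
    also have "dist f (h n) \<le> s n" using sV[of n] by (simp add: h_def dist_norm)
    finally show ?thesis using \<open>k > 0\<close> by simp
  qed
  moreover have "\<exists>x\<in>A. peak A (h n) = \<Psi> (x + h n x)" for n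
    by (rule peak_attained(1)[OF A(1-3) hnorm])
  ultimately have "\<exists>x\<in>A. peak A f \<le> \<Psi> (x + f x + s n *\<^sub>R v x) + k * s n" for n
    unfolding happ by (metis add.assoc)
  then obtain x where x: "\<And>n. x n \<in> A" "\<And>n. peak A f \<le> \<Psi> (x n + f (x n) + s n *\<^sub>R v (x n)) + k * s n"
    by metis
  have "\<exists>z. norm (z - (x n + f (x n))) \<le> s n \<and> - k \<le> blinfun_apply (G z) (v (x n))" for n
  proof -
    let ?y = "x n + f (x n)"
    have seg: "?y + t *\<^sub>R (s n *\<^sub>R v (x n)) \<noteq> 0" if "0 \<le> t" "t \<le> 1" for t
    proof -
      have "norm (f + (t * s n) *\<^sub>R V) \<le> 1/2"
      proof -
        have "norm ((t * s n) *\<^sub>R V) \<le> 1 * s n"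
          using mult_mono[OF \<open>t \<le> 1\<close> sV[of n]] s(1)[of n] that(1) by (simp add: mult.assoc)
        then show ?thesis using norm_triangle_ineq[of f "(t * s n) *\<^sub>R V"] s(2)[of n] f(1) by linarith
      qed
      then have "x n + apply_bcontfun (f + (t * s n) *\<^sub>R V) (x n) \<noteq> 0"
        using displaced_nonzero A(3) x(1) by fastforce
      then show ?thesis by (simp add: V add.assoc)
    qed
    obtain t where t: "t \<in> {0..1}" "\<Psi> (?y + s n *\<^sub>R v (x n)) - \<Psi> ?y
        = blinfun_apply (G (?y + t *\<^sub>R (s n *\<^sub>R v (x n)))) (s n *\<^sub>R v (x n))"
      using line_mean_value[of \<Psi> G ?y "s n *\<^sub>R v (x n)"] deriv[OF seg] by blast
    let ?z = "?y + t *\<^sub>R (s n *\<^sub>R v (x n))"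
    have "\<Psi> ?y \<le> peak A f"
      by (rule peak_attained(2)[OF A(1-3) _ x(1)]) (use f(1) in simp)
    then have "- k * s n \<le> s n * blinfun_apply (G ?z) (v (x n))"
      using t(2) x(2)[of n] by (simp add: blinfun.scaleR_right)
    then have "- k \<le> blinfun_apply (G ?z) (v (x n))"
      using s(1)[of n] by (metis mult.commute mult_le_cancel_left_pos)
    moreover have "norm (?z - ?y) \<le> s n"
    proof -
      have "norm (?z - ?y) = t * (s n * norm (v (x n)))" using t(1) s(1)[of n] by simp
      also have "\<dots> \<le> 1 * (s n * 1)"
        using t(1) s(1)[of n] v(2)[of "x n"] by (intro mult_mono) auto
      finally show ?thesis by simp
    qed
    ultimately show ?thesis by blast
  qed
  then obtain z where z: "\<And>n. norm (z n - (x n + f (x n))) \<le> s n"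
    "\<And>n. - k \<le> blinfun_apply (G (z n)) (v (x n))" by metis
  obtain l \<sigma> where l: "l \<in> A" "strict_mono \<sigma>" "(x \<circ> \<sigma>) \<longlonglongrightarrow> l"
    using A(1) x(1) unfolding compact_def by metis
  have xl: "(\<lambda>n. x (\<sigma> n)) \<longlonglongrightarrow> l" using l(3) by (simp add: o_def)
  have s\<sigma>: "(\<lambda>n. s (\<sigma> n)) \<longlonglongrightarrow> 0" using LIMSEQ_subseq_LIMSEQ[OF s0 l(2)] by (simp add: o_def)
  have fl: "(\<lambda>n. f (x (\<sigma> n))) \<longlonglongrightarrow> f l"
    using continuous_on_tendsto_compose[OF continuous_on_apply_bcontfun[of UNIV f] xl] by simp
  have vl: "(\<lambda>n. v (x (\<sigma> n))) \<longlonglongrightarrow> v l"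
    using continuous_on_tendsto_compose[OF v(1) xl] by simp
  have yl: "(\<lambda>n. x (\<sigma> n) + f (x (\<sigma> n))) \<longlonglongrightarrow> l + f l" by (intro tendsto_intros xl fl)
  have "(\<lambda>n. z (\<sigma> n) - (x (\<sigma> n) + f (x (\<sigma> n)))) \<longlonglongrightarrow> 0"
    by (rule Lim_null_comparison[OF _ s\<sigma>]) (simp add: z(1))
  from tendsto_add[OF this yl] have zl: "(\<lambda>n. z (\<sigma> n)) \<longlonglongrightarrow> l + f l" by simp
  have "(\<lambda>n. blinfun_apply (G (z (\<sigma> n))) (v (x (\<sigma> n)))) \<longlonglongrightarrow> blinfun_apply (G (l + f l)) (v l)"
    by (intro tendsto_intros tendsto_G zl vl nz l(1))
  then have "- k \<le> blinfun_apply (G (l + f l)) (v l)"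
    by (rule LIMSEQ_le_const) (use z(2) in blast)
  moreover have "l \<in> D"
  proof -
    have "(\<lambda>n. x (\<sigma> n) + f (x (\<sigma> n)) + s (\<sigma> n) *\<^sub>R v (x (\<sigma> n))) \<longlonglongrightarrow> l + f l + 0 *\<^sub>R v l"
      by (intro tendsto_intros yl s\<sigma> vl)
    then have "(\<lambda>n. x (\<sigma> n) + f (x (\<sigma> n)) + s (\<sigma> n) *\<^sub>R v (x (\<sigma> n))) \<longlonglongrightarrow> l + f l" by simp
    from tendsto_\<Psi>[OF this nz[OF l(1)]]
    have "(\<lambda>n. \<Psi> (x (\<sigma> n) + f (x (\<sigma> n)) + s (\<sigma> n) *\<^sub>R v (x (\<sigma> n))) + k * s (\<sigma> n))
        \<longlonglongrightarrow> \<Psi> (l + f l) + k * 0"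
      by (intro tendsto_intros s\<sigma>)
    then have "peak A f \<le> \<Psi> (l + f l) + k * 0"
      by (rule LIMSEQ_le_const) (use x(2) in blast)
    moreover have "\<Psi> (l + f l) \<le> peak A f"
      by (rule peak_attained(2)[OF A(1-3) _ l(1)]) (use f(1) in simp)
    ultimately show ?thesis using l(1) by (simp add: D_def)
  qed
  ultimately show False using v(4)[of l] \<open>k > 0\<close> by simp
qed

text \<open>The peak is a supremum of continuous functions of \<open>f\<close>, hence lower semicontinuous.\<close>
lemma closed_peak_sublevel:
  assumes A: "compact A" "A \<noteq> {}" "A \<subseteq> sphere 0 1"
  shows "closed {f \<in> {f. norm f \<le> 1/2 \<and> (\<forall>x. apply_bcontfun f (- x) = - apply_bcontfun f x)}. peak A f \<le> a}"
    (is "closed {f \<in> ?M. _ f}")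
  unfolding closed_sequential_limits
proof (intro allI impI)
  fix X f assume X: "(\<forall>n. X n \<in> {f \<in> ?M. peak A f \<le> a}) \<and> X \<longlonglongrightarrow> f"
  have pt: "(\<lambda>n. apply_bcontfun (X n) x) \<longlonglongrightarrow> apply_bcontfun f x" for x
  proof -
    have "X \<longlonglongrightarrow> f" using X by (rule conjunct2)
    then have "(\<lambda>n. norm (X n - f)) \<longlonglongrightarrow> 0" by (intro tendsto_norm_zero LIM_zero)
    moreover have "norm (apply_bcontfun (X n) x - apply_bcontfun f x) \<le> norm (X n - f)" for n
      using norm_bounded[of "X n - f" x] by simp
    ultimately have "(\<lambda>n. apply_bcontfun (X n) x - apply_bcontfun f x) \<longlonglongrightarrow> 0"
      by (rule Lim_null_comparison[OF always_eventually[OF allI], rotated])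
    then show ?thesis by (simp add: LIM_zero_iff)
  qed
  have nf: "norm f \<le> 1/2"
    using X by (intro LIMSEQ_le_const2[OF tendsto_norm[of X f sequentially]]) auto
  moreover have "apply_bcontfun f (- x) = - apply_bcontfun f x" for x
  proof (rule LIMSEQ_unique[OF pt])
    show "(\<lambda>n. apply_bcontfun (X n) (- x)) \<longlonglongrightarrow> - apply_bcontfun f x"
      using tendsto_minus[OF pt[of x]] X by simp
  qed
  moreover have "peak A f \<le> a"
  proof -
    obtain x where x: "x \<in> A" "peak A f = \<Psi> (x + apply_bcontfun f x)"
      using peak_attained(1)[OF A nf] by blast
    have "x + apply_bcontfun f x \<noteq> 0" using displaced_nonzero[OF _ nf] x(1) A(3) by auto
    then have "(\<lambda>n. \<Psi> (x + apply_bcontfun (X n) x)) \<longlonglongrightarrow> \<Psi> (x + apply_bcontfun f x)"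
      by (intro tendsto_\<Psi> tendsto_intros pt)
    moreover have "\<Psi> (x + apply_bcontfun (X n) x) \<le> a" for n
    proof -
      have "norm (X n) \<le> 1/2" "peak A (X n) \<le> a" using X by auto
      then show ?thesis using peak_attained(2)[OF A _ x(1), of "X n"] by linarith
    qed
    ultimately show ?thesis unfolding x(2) by (intro LIMSEQ_le_const2) auto
  qed
  ultimately show "f \<in> {f \<in> ?M. peak A f \<le> a}" by simp
qed

text \<open>
  Suppose that no odd displacement brings the peak down to \<open>c - \<epsilon>\<close>. Since the zero displacement
  starts at most \<open>2 * \<epsilon>\<close> higher, Ekeland's principle provides a displacement \<open>f\<close> of norm at most
  \<open>2 * \<epsilon> / k\<close> that no step improves at rate \<open>k\<close>. As \<open>f\<close> is small, the displaced points are
  still far from the critical directions at level \<open>c\<close>, so the gradient is large there and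
  \<open>descent_step\<close> does improve it.
\<close>
lemma deformation:
  assumes "d > 0"
  shows "\<exists>\<epsilon>>0. \<forall>A. compact A \<and> A \<subseteq> sphere 0 1 \<and> (\<forall>x\<in>A. - x \<in> A) \<and> (\<forall>x\<in>A. \<Psi> x \<le> c + \<epsilon>) \<and>
      (\<forall>x\<in>A. \<forall>k\<in>crit_dirs c. d \<le> dist x k) \<longrightarrow>
    (\<exists>g. continuous_on A g \<and> (\<forall>x\<in>A. g (- x) = - g x) \<and> g ` A \<subseteq> sphere 0 1 \<and> (\<forall>x\<in>A. \<Psi> (g x) \<le> c - \<epsilon>))"
proof -
  obtain \<epsilon>\<^sub>0 where \<epsilon>\<^sub>0: "\<epsilon>\<^sub>0 > 0" "\<And>u. norm u = 1 \<Longrightarrow> \<bar>\<Psi> u - c\<bar> \<le> \<epsilon>\<^sub>0 \<Longrightarrow>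
      (\<And>k. k \<in> crit_dirs c \<Longrightarrow> d / 2 \<le> dist u k) \<Longrightarrow> \<epsilon>\<^sub>0 \<le> norm (G u)"
    using gradient_gap[of "d / 2" c] assms by auto
  \<comment> \<open>\<open>m\<close> bounds the displacement: after renormalising, a point has moved by at most \<open>2 * m \<le> d / 2\<close>.
    The gradient at a displaced point, whose norm is at most 2, is at least \<open>\<epsilon>\<^sub>0 / 2 > 2 * k\<close>.\<close>
  define k where "k = \<epsilon>\<^sub>0 / 8"
  define m where "m = min (1/4) (d / 4)"
  define \<epsilon> where "\<epsilon> = min \<epsilon>\<^sub>0 (k * m / 2)"
  have pos: "k > 0" "m > 0" "\<epsilon> > 0" using \<epsilon>\<^sub>0(1) assms by (auto simp: k_def m_def \<epsilon>_def)
  have m: "m \<le> 1/4" "m \<le> d / 4" by (auto simp: m_def)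
  have \<epsilon>: "\<epsilon> \<le> \<epsilon>\<^sub>0" "2 * \<epsilon> \<le> k * m" by (auto simp: \<epsilon>_def)
  have deform: "\<exists>g. continuous_on A g \<and> (\<forall>x\<in>A. g (- x) = - g x) \<and> g ` A \<subseteq> sphere 0 1 \<and> (\<forall>x\<in>A. \<Psi> (g x) \<le> c - \<epsilon>)"
    if A: "compact A" "A \<subseteq> sphere 0 1" "\<And>x. x \<in> A \<Longrightarrow> - x \<in> A" "\<And>x. x \<in> A \<Longrightarrow> \<Psi> x \<le> c + \<epsilon>"
      "\<And>x k. x \<in> A \<Longrightarrow> k \<in> crit_dirs c \<Longrightarrow> d \<le> dist x k" for A
  proof (cases "A = {}")
    case False
    let ?M = "{f. norm f \<le> 1/2 \<and> (\<forall>x. apply_bcontfun f (- x) = - apply_bcontfun f x)}"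
    note P = peak_attained[OF A(1) False A(2)]
    have "\<exists>f\<in>?M. peak A f \<le> c - \<epsilon>"
    proof (rule ccontr)
      assume "\<not> ?thesis"
      then have high: "\<And>f. f \<in> ?M \<Longrightarrow> c - \<epsilon> \<le> peak A f" by force
      have "\<exists>f\<in>?M. peak A f + k * dist 0 f \<le> peak A 0 \<and>
          (\<forall>h\<in>?M. peak A h + k * dist f h \<le> peak A f \<longrightarrow> h = f)"
        by (rule ekeland_variational_principle[OF _ closed_peak_sublevel[OF A(1) False A(2)] high pos(1)])
           simp_all
      then obtain f where f: "f \<in> ?M" "peak A f + k * norm f \<le> peak A 0"
        and f_min: "\<And>h. h \<in> ?M \<Longrightarrow> peak A h + k * dist f h \<le> peak A f \<Longrightarrow> h = f"
        by (auto simp: dist_norm)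
      have "peak A 0 \<le> c + \<epsilon>" using P(1)[of 0] A(4) by auto
      moreover have "0 \<le> k * norm f" using pos(1) by simp
      ultimately have lev: "peak A f \<le> c + \<epsilon>" and "k * norm f \<le> k * m"
        using f(2) high[OF f(1)] \<epsilon>(2) by linarith+
      then have fm: "norm f \<le> m" using pos(1) by simp
      have "2 * k < norm (G (x + apply_bcontfun f x))"
        if x: "x \<in> A" "\<Psi> (x + apply_bcontfun f x) = peak A f" for x
      proof -
        let ?y = "x + apply_bcontfun f x"
        define u where "u = ?y /\<^sub>R norm ?y"
        have nx: "norm x = 1" using x(1) A(2) by auto
        note ny = displaced_norm[OF nx fm]
        have y0: "norm ?y > 0" using ny(1) m(1) by linarith
        have nu: "norm u = 1" unfolding u_def using y0 by simp
        have yu: "?y = norm ?y *\<^sub>R u" unfolding u_def using y0 by simp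
        have "\<Psi> u = peak A f" unfolding u_def using homog[of "inverse (norm ?y)" ?y] y0 x(2) by simp
        then have "\<bar>\<Psi> u - c\<bar> \<le> \<epsilon>\<^sub>0" using lev high[OF f(1)] \<epsilon>(1) by linarith
        moreover have "d / 2 \<le> dist u k'" if "k' \<in> crit_dirs c" for k'
        proof -
          have "dist ?y u = \<bar>norm ?y - 1\<bar>"
          proof -
            have "?y - u = (norm ?y - 1) *\<^sub>R u" by (subst yu) (simp add: scaleR_diff_left)
            then show ?thesis by (simp add: dist_norm nu)
          qed
          also have "\<dots> \<le> m" using ny by linarith
          finally have "dist ?y u \<le> m" .
          moreover have "dist x ?y \<le> m" using norm_bounded[of f x] fm by (simp add: dist_norm)
          moreover have "d \<le> dist x k'" using A(5)[OF x(1) that] .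
          moreover have "dist x k' \<le> dist x ?y + dist ?y u + dist u k'"
            using dist_triangle[of x k' ?y] dist_triangle[of ?y k' u] by linarith
          ultimately show ?thesis using m(2) by linarith
        qed
        ultimately have "\<epsilon>\<^sub>0 \<le> norm (G u)" by (rule \<epsilon>\<^sub>0(2)[OF nu])
        also have "G u = norm ?y *\<^sub>R G ?y"
        proof -
          have "u \<noteq> 0" using nu by auto
          from G_homog[OF this y0] show ?thesis unfolding yu[symmetric] .
        qed
        also have "norm (norm ?y *\<^sub>R G ?y) = norm ?y * norm (G ?y)" by simp
        also have "\<dots> \<le> 2 * norm (G ?y)" using ny(2) m(1) by (intro mult_right_mono) auto
        finally show ?thesis using \<epsilon>\<^sub>0(1) unfolding k_def by linarith
      qed
      then obtain h where "h \<in> ?M" "peak A h + k * dist f h < peak A f"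
        using descent_step[OF A(1) False A(2,3), of f k] f(1) fm m(1) pos(1) by auto
      then show False using f_min[of h] by auto
    qed
    then obtain f where f: "norm f \<le> 1/2" "\<And>x. apply_bcontfun f (- x) = - apply_bcontfun f x"
      "peak A f \<le> c - \<epsilon>" by auto
    define g where "g x = (x + apply_bcontfun f x) /\<^sub>R norm (x + apply_bcontfun f x)" for x
    have nz: "x + apply_bcontfun f x \<noteq> 0" if "x \<in> A" for x
      using displaced_nonzero[of x f] A(2) f(1) that by auto
    have "continuous_on A g"
      unfolding g_def using nz by (intro continuous_intros) auto
    moreover have "g (- x) = - g x" for x
    proof -
      have "- x + apply_bcontfun f (- x) = - (x + apply_bcontfun f x)" by (simp add: f(2))
      then show ?thesis unfolding g_def by (metis norm_minus_cancel scaleR_minus_right)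
    qed
    moreover have "g ` A \<subseteq> sphere 0 1" using nz by (auto simp: g_def)
    moreover have "\<Psi> (g x) \<le> c - \<epsilon>" if "x \<in> A" for x
    proof -
      have "\<Psi> (g x) = \<Psi> (x + apply_bcontfun f x)" unfolding g_def using nz[OF that] by (intro homog) simp
      then show ?thesis using P(2)[OF f(1) that] f(3) by linarith
    qed
    ultimately show ?thesis by blast
  qed auto
  show ?thesis
    by (intro exI[of _ \<epsilon>] conjI allI impI pos(3), elim conjE, rule deform) auto
qed

text \<open>
  The sublevel of \<open>\<Psi>\<close> at \<open>a\<close> has genus at most \<open>j\<close>, tested on its compact symmetric subsets only, because
  only compact sets are deformed. The minimax level \<open>c\<^sub>j\<close> is the infimum of the \<open>a\<close> for which this fails.
\<close>
definition sublevel_cover :: "real \<Rightarrow> nat \<Rightarrow> bool" where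
  "sublevel_cover a j \<longleftrightarrow> (\<forall>A. compact A \<and> A \<subseteq> sphere 0 1 \<and> (\<forall>x\<in>A. - x \<in> A) \<and> (\<forall>x\<in>A. \<Psi> x \<le> a)
     \<longrightarrow> antipodal_cover A j)"

lemma sublevel_cover_pass:
  assumes "d > 0"
  shows "\<exists>\<epsilon>>0. \<forall>j A. sublevel_cover (c - \<epsilon>) j \<and> compact A \<and> A \<subseteq> sphere 0 1 \<and> (\<forall>x\<in>A. - x \<in> A) \<and>
      (\<forall>x\<in>A. \<Psi> x \<le> c + \<epsilon>) \<and> (\<forall>x\<in>A. \<forall>k\<in>crit_dirs c. d \<le> dist x k) \<longrightarrow> antipodal_cover A j"
proof -
  obtain \<epsilon> where \<epsilon>: "\<epsilon> > 0"
    and push_down: "\<And>A. compact A \<and> A \<subseteq> sphere 0 1 \<and> (\<forall>x\<in>A. - x \<in> A) \<and> (\<forall>x\<in>A. \<Psi> x \<le> c + \<epsilon>) \<and>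
      (\<forall>x\<in>A. \<forall>k\<in>crit_dirs c. d \<le> dist x k) \<Longrightarrow>
    \<exists>g. continuous_on A g \<and> (\<forall>x\<in>A. g (- x) = - g x) \<and> g ` A \<subseteq> sphere 0 1 \<and> (\<forall>x\<in>A. \<Psi> (g x) \<le> c - \<epsilon>)"
    using deformation[OF assms, of c] by auto
  have "antipodal_cover A j"
    if "sublevel_cover (c - \<epsilon>) j" and A: "compact A" "A \<subseteq> sphere 0 1" "\<forall>x\<in>A. - x \<in> A"
      "\<forall>x\<in>A. \<Psi> x \<le> c + \<epsilon>" "\<forall>x\<in>A. \<forall>k\<in>crit_dirs c. d \<le> dist x k" for j A
  proof -
    have "\<exists>g. continuous_on A g \<and> (\<forall>x\<in>A. g (- x) = - g x) \<and> g ` A \<subseteq> sphere 0 1 \<and> (\<forall>x\<in>A. \<Psi> (g x) \<le> c - \<epsilon>)"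
      by (rule push_down) (intro conjI A)
    then obtain g where g: "continuous_on A g" "\<forall>x\<in>A. g (- x) = - g x" "g ` A \<subseteq> sphere 0 1"
      "\<forall>x\<in>A. \<Psi> (g x) \<le> c - \<epsilon>"
      by (elim exE conjE)
    have "compact (g ` A)" using g(1) A(1) by (rule compact_continuous_image)
    moreover have "\<forall>y\<in>g ` A. - y \<in> g ` A"
    proof clarify
      fix x assume "x \<in> A"
      then show "- g x \<in> g ` A" using g(2) A(3) by (intro image_eqI[of _ g "- x"]) auto
    qed
    ultimately have "antipodal_cover (g ` A) j"
      using that(1) g(3,4) unfolding sublevel_cover_def by simp
    then show ?thesis by (rule antipodal_cover_pullback[OF _ A(1) g(1)]) (use A(3) g(2) in auto)
  qed
  then show ?thesis using \<epsilon> by blast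
qed

lemma sublevel_cover_regular:
  assumes "crit_dirs c = {}"
  shows "\<exists>\<epsilon>>0. \<forall>j. sublevel_cover (c - \<epsilon>) j \<longrightarrow> sublevel_cover (c + \<epsilon>) j"
  using sublevel_cover_pass[of 1 c] assms unfolding sublevel_cover_def[of "c + _"] by auto

lemma crit_dirs_minus:
  assumes "k \<in> crit_dirs c"
  shows "- k \<in> crit_dirs c"
proof -
  have "k \<noteq> 0" using assms unfolding crit_dirs_def by auto
  then show ?thesis using assms even[of k] G_odd[of k] unfolding crit_dirs_def by simp
qed

text \<open>
  Crossing a level with finitely many critical directions costs one pair: the closed balls of radius \<open>d\<close> around
  one half of these directions form an antipode-free closed set, and the rest of the set can be deformed
  past the level.
\<close>
lemma sublevel_cover_critical:
  assumes "finite (crit_dirs c)"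
  shows "\<exists>\<epsilon>>0. \<forall>j. sublevel_cover (c - \<epsilon>) j \<longrightarrow> sublevel_cover (c + \<epsilon>) (Suc j)"
proof -
  have "0 \<notin> crit_dirs c" by (simp add: crit_dirs_def)
  then obtain P where P: "finite P" "crit_dirs c \<subseteq> P \<union> uminus ` P" "P \<inter> uminus ` P = {}"
    using finite_antipodal_half[OF assms] by blast
  define S where "S = insert 1 ((\<lambda>(x, y). dist x (- y)) ` (P \<times> P))"
  have "finite S" using P(1) by (simp add: S_def)
  moreover have "\<forall>s\<in>S. s > 0" using P(3) by (auto simp: S_def)
  ultimately have "Min S > 0" using Min_in[of S] unfolding S_def by blast
  define d where "d = Min S / 3"
  have d: "d > 0" using \<open>Min S > 0\<close> by (simp add: d_def)
  have sep: "3 * d \<le> dist x (- y)" if "x \<in> P" "y \<in> P" for x y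
  proof -
    have "dist x (- y) \<in> S" unfolding S_def using that by force
    then show ?thesis using \<open>finite S\<close> by (simp add: d_def)
  qed
  define E where "E = (\<Union>p\<in>P. cball p d)"
  have "closed E" unfolding E_def using P(1) by (intro closed_UN) auto
  have E_free: "- x \<notin> E" if "x \<in> E" for x
  proof
    assume "- x \<in> E"
    then obtain p q where pq: "p \<in> P" "q \<in> P" "dist p x \<le> d" "dist q (- x) \<le> d"
      using \<open>x \<in> E\<close> unfolding E_def by auto
    have "dist q (- x) = dist x (- q)"
      by (metis add.inverse_inverse dist_commute dist_minus)
    then have "dist p (- q) \<le> 2 * d" using dist_triangle[of p "- q" x] pq(3,4) by linarith
    then show False using sep[OF pq(1,2)] d by linarith
  qed
  obtain \<epsilon> where \<epsilon>: "\<epsilon> > 0" and pass: "\<And>j A. sublevel_cover (c - \<epsilon>) j \<and> compact A \<and>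
      A \<subseteq> sphere 0 1 \<and> (\<forall>x\<in>A. - x \<in> A) \<and> (\<forall>x\<in>A. \<Psi> x \<le> c + \<epsilon>) \<and>
      (\<forall>x\<in>A. \<forall>k\<in>crit_dirs c. d \<le> dist x k) \<Longrightarrow> antipodal_cover A j"
    using sublevel_cover_pass[OF d, of c] by auto
  have "sublevel_cover (c + \<epsilon>) (Suc j)" if j: "sublevel_cover (c - \<epsilon>) j" for j
    unfolding sublevel_cover_def
  proof (intro allI impI, elim conjE)
    fix A :: "'a set"
    assume A: "compact A" "A \<subseteq> sphere 0 1" "\<forall>x\<in>A. - x \<in> A" "\<forall>x\<in>A. \<Psi> x \<le> c + \<epsilon>"
    define B where "B = A \<inter> (\<Inter>k\<in>crit_dirs c. {x. d \<le> dist x k})"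
    have "closed {x. d \<le> dist x k}" for k :: 'a
      by (intro closed_Collect_le continuous_intros)
    then have "closed (\<Inter>k\<in>crit_dirs c. {x. d \<le> dist x k})" by (intro closed_INT ballI)
    then have "compact B" unfolding B_def using A(1) by (rule compact_Int_closed[rotated])
    moreover have "\<forall>x\<in>B. - x \<in> B"
    proof
      fix x assume "x \<in> B"
      have "d \<le> dist (- x) k" if "k \<in> crit_dirs c" for k
      proof -
        have "dist (- x) k = dist x (- k)" by (metis add.inverse_inverse dist_minus)
        then show ?thesis using \<open>x \<in> B\<close> crit_dirs_minus[OF that] unfolding B_def by auto
      qed
      then show "- x \<in> B" using \<open>x \<in> B\<close> A(3) unfolding B_def by auto
    qed
    ultimately have "antipodal_cover B j"
      using j A(2,4) by (intro pass) (auto simp: B_def)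
    then show "antipodal_cover A (Suc j)"
    proof (rule antipodal_cover_insert[OF _ \<open>closed E\<close> E_free])
      fix x assume "x \<in> A"
      show "x \<in> B \<or> x \<in> E \<or> - x \<in> E"
      proof (cases "x \<in> B")
        case False
        then obtain k where k: "k \<in> crit_dirs c" "dist x k < d"
          using \<open>x \<in> A\<close> unfolding B_def by auto
        have "k \<in> P \<or> - k \<in> P" using P(2) k(1) by auto
        moreover have "dist (- x) (- k) = dist x k" by (rule dist_minus)
        ultimately show ?thesis using k(2) unfolding E_def
          by (metis UN_iff dist_commute less_imp_le mem_cball)
      qed simp
    qed
  qed
  then show ?thesis using \<epsilon> by blast
qed

lemma sublevel_cover_antimono: "sublevel_cover a' j \<Longrightarrow> a \<le> a' \<Longrightarrow> sublevel_cover a j"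
  unfolding sublevel_cover_def by (meson order_trans)

text \<open>
  If there were only finitely many critical directions, the minimax levels would form a strictly
  increasing sequence of critical values.
\<close>
theorem infinite_critical_directions:
  assumes "infinite_dimensional TYPE('a)"
  shows "infinite {u. norm u = 1 \<and> G u = 0}" (is "infinite ?K")
proof
  assume fin: "finite ?K"
  have fin_c: "finite (crit_dirs c)" for c
    by (rule finite_subset[OF _ fin]) (auto simp: crit_dirs_def)
  define level where "level j = Inf {a. \<not> sublevel_cover a j}" for j
  have ne: "{a. \<not> sublevel_cover a j} \<noteq> {}" for j
  proof -
    obtain A :: "'a set" where A: "compact A" "A \<subseteq> sphere 0 1" "\<forall>x\<in>A. - x \<in> A" "\<not> antipodal_cover A j"
      using lusternik_schnirelmann_covering[OF assms, of j] by blast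
    have "continuous_on A \<Psi>" by (rule continuous_on_subset[OF continuous_\<Psi>]) (use A(2) in auto)
    then have "bounded (\<Psi> ` A)" using A(1) by (intro compact_imp_bounded compact_continuous_image)
    then obtain a where "\<forall>x\<in>A. \<Psi> x \<le> a" unfolding bounded_iff by (metis abs_le_D1 image_eqI real_norm_def)
    then have "\<not> sublevel_cover a j" using A unfolding sublevel_cover_def by blast
    then show ?thesis by blast
  qed
  have lower: "b \<le> a" if "\<not> sublevel_cover a j" for a j
  proof (rule ccontr)
    assume "\<not> b \<le> a"
    have "antipodal_cover A j" if "A \<subseteq> sphere 0 1" "\<forall>x\<in>A. \<Psi> x \<le> a" for A
    proof -
      have "A = {}"
      proof (rule ccontr)
        assume "A \<noteq> {}"
        then obtain x where "x \<in> A" by blast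
        then have "x \<noteq> 0" "\<Psi> x \<le> a" using that by auto
        then show False using below[of x] \<open>\<not> b \<le> a\<close> by linarith
      qed
      then show ?thesis unfolding antipodal_cover_def by (intro exI[of _ "\<lambda>_. {}"]) simp
    qed
    then show False using that unfolding sublevel_cover_def by blast
  qed
  have bdd: "bdd_below {a. \<not> sublevel_cover a j}" for j using lower by (intro bdd_belowI[of _ b]) simp
  have under: "sublevel_cover a j" if "a < level j" for a j
    using cInf_lower[OF _ bdd, of a j] that unfolding level_def by fastforce
  have over: "a \<le> level j" if "sublevel_cover a j" for a j
    unfolding level_def
  proof (rule cInf_greatest[OF ne])
    fix t assume "t \<in> {a. \<not> sublevel_cover a j}"
    then show "a \<le> t" using sublevel_cover_antimono[OF that, of t] by force
  qed
  have crit: "crit_dirs (level j) \<noteq> {}" for j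
  proof
    assume "crit_dirs (level j) = {}"
    then obtain \<epsilon> where "\<epsilon> > 0" "sublevel_cover (level j - \<epsilon>) j \<longrightarrow> sublevel_cover (level j + \<epsilon>) j"
      using sublevel_cover_regular by blast
    then show False using under[of "level j - \<epsilon>" j] over[of "level j + \<epsilon>" j] by simp
  qed
  have "level j < level (Suc j)" for j
  proof -
    obtain \<epsilon> where "\<epsilon> > 0" "sublevel_cover (level j - \<epsilon>) j \<longrightarrow> sublevel_cover (level j + \<epsilon>) (Suc j)"
      using sublevel_cover_critical[OF fin_c] by blast
    then show ?thesis using under[of "level j - \<epsilon>" j] over[of "level j + \<epsilon>" "Suc j"] by simp
  qed
  then have "strict_mono level" by (simp add: strict_mono_Suc_iff)
  then have "inj level" by (rule strict_mono_imp_inj_on)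
  moreover have "range level \<subseteq> \<Psi> ` ?K"
  proof clarify
    fix j
    obtain u where "u \<in> crit_dirs (level j)" using crit by blast
    then show "level j \<in> \<Psi> ` ?K" unfolding crit_dirs_def by force
  qed
  then have "finite (range level)" using fin finite_subset by blast
  ultimately show False using finite_imageD infinite_UNIV_nat by blast
qed

end

section \<open>Reduction along the fibres\<close>

text \<open>
  The properties of \<open>\<Phi>\<close> that determine its shape along rays, and the compactness on the Nehari set
  that is carried over to the unit sphere. The radius \<open>\<rho>\<close> bounds the
  Nehari set away from \<open>0\<close>.
\<close>
locale fibered_functional =
  fixes \<Phi> :: "'a::banach \<Rightarrow> real" and \<Phi>' :: "'a \<Rightarrow> 'a \<Rightarrow>\<^sub>L real" and p \<rho> :: real
  assumes C1: "C1_on UNIV \<Phi> \<Phi>'"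
    and zero: "\<Phi> 0 = 0"
    and even: "\<Phi> (- u) = \<Phi> u"
    and \<rho>: "\<rho> > 0"
    and near_zero: "u \<noteq> 0 \<Longrightarrow> norm u < \<rho> \<Longrightarrow> 0 < blinfun_apply (\<Phi>' u) u"
    and far: "u \<noteq> 0 \<Longrightarrow> \<exists>t>0. \<Phi> (t *\<^sub>R u) < 0"
    and decreasing: "u \<noteq> 0 \<Longrightarrow>
      strict_antimono_on {0<..} (\<lambda>t. blinfun_apply (\<Phi>' (t *\<^sub>R u)) u / t powr (p - 1))"
    and PS: "palais_smale_on (nehari \<Phi>') \<Phi> \<Phi>'"
begin

lemma deriv: "(\<Phi> has_derivative blinfun_apply (\<Phi>' u)) (at u)"
  using C1 unfolding C1_on_def by simp

lemma tendsto_\<Phi>' [tendsto_intros]: "(X \<longlongrightarrow> x) F \<Longrightarrow> ((\<lambda>n. \<Phi>' (X n)) \<longlongrightarrow> \<Phi>' x) F"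
  using C1 unfolding C1_on_def
  by (intro isCont_tendsto_compose[of x \<Phi>']) (simp_all add: continuous_on_eq_continuous_at)

lemma tendsto_\<Phi> [tendsto_intros]: "(X \<longlongrightarrow> x) F \<Longrightarrow> ((\<lambda>n. \<Phi> (X n)) \<longlongrightarrow> \<Phi> x) F"
  by (rule isCont_tendsto_compose[OF has_derivative_continuous[OF deriv]])

lemma odd: "\<Phi>' (- u) = - \<Phi>' u"
proof (rule blinfun_eqI)
  fix h
  have "((\<lambda>x. \<Phi> (- x)) has_derivative (\<lambda>h. blinfun_apply (\<Phi>' (- u)) (- h))) (at u)"
    by (rule has_derivative_compose[of "\<lambda>x. - x" "\<lambda>h. - h" u UNIV \<Phi>, OF _ deriv])
       (auto intro!: derivative_eq_intros)
  then have "blinfun_apply (\<Phi>' u) = (\<lambda>h. blinfun_apply (\<Phi>' (- u)) (- h))"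
    using deriv[of u] has_derivative_unique unfolding even by blast
  then show "blinfun_apply (\<Phi>' (- u)) h = blinfun_apply (- \<Phi>' u) h"
    by (simp add: blinfun.minus_left blinfun.minus_right)
qed

lemma fiber_DERIV: "((\<lambda>t. \<Phi> (t *\<^sub>R u)) has_real_derivative blinfun_apply (\<Phi>' (t *\<^sub>R u)) u) (at t)"
proof -
  have "((\<lambda>t. \<Phi> (t *\<^sub>R u)) has_derivative (\<lambda>h. blinfun_apply (\<Phi>' (t *\<^sub>R u)) (h *\<^sub>R u))) (at t)"
    by (rule has_derivative_compose[of "\<lambda>t. t *\<^sub>R u" "\<lambda>h. h *\<^sub>R u" t UNIV \<Phi>, OF _ deriv])
       (auto intro!: derivative_eq_intros)
  moreover have "(\<lambda>h. blinfun_apply (\<Phi>' (t *\<^sub>R u)) (h *\<^sub>R u)) = (*) (blinfun_apply (\<Phi>' (t *\<^sub>R u)) u)"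
    by (auto simp: blinfun.scaleR_right)
  ultimately show ?thesis unfolding has_field_derivative_def by simp
qed

lemma fiber_sign_transfer:
  assumes "u \<noteq> 0" "0 < s" "s < t"
  shows "0 \<le> blinfun_apply (\<Phi>' (t *\<^sub>R u)) u \<Longrightarrow> 0 < blinfun_apply (\<Phi>' (s *\<^sub>R u)) u"
    and "blinfun_apply (\<Phi>' (s *\<^sub>R u)) u \<le> 0 \<Longrightarrow> blinfun_apply (\<Phi>' (t *\<^sub>R u)) u < 0"
proof -
  let ?f = "\<lambda>t. blinfun_apply (\<Phi>' (t *\<^sub>R u)) u"
  have less: "?f t / t powr (p - 1) < ?f s / s powr (p - 1)"
    using monotone_onD[OF decreasing[OF assms(1)], of s t] assms(2,3) by simp
  have pos: "t powr (p - 1) > 0" "s powr (p - 1) > 0" using assms by auto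
  show "0 \<le> ?f t \<Longrightarrow> 0 < ?f s"
    using less pos by (metis divide_nonneg_pos le_less_trans zero_less_divide_iff order_less_asym)
  show "?f s \<le> 0 \<Longrightarrow> ?f t < 0"
    using less pos by (metis divide_nonpos_pos less_le_trans divide_less_0_iff order_less_asym)
qed

text \<open>
  The derivative along the ray is positive near \<open>0\<close>, and by the mean value theorem it is negative somewhere,
  because \<open>\<Phi>\<close> falls from \<open>0\<close> to a negative value.
\<close>
lemma fiber_zero_exists:
  assumes "u \<noteq> 0"
  shows "\<exists>t>0. blinfun_apply (\<Phi>' (t *\<^sub>R u)) u = 0"
proof -
  let ?f = "\<lambda>t. blinfun_apply (\<Phi>' (t *\<^sub>R u)) u"
  define a where "a = \<rho> / (2 * norm u)"
  have "a > 0" using \<rho> assms by (simp add: a_def)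
  have "norm (a *\<^sub>R u) < \<rho>" using \<rho> assms by (simp add: a_def)
  then have "0 < blinfun_apply (\<Phi>' (a *\<^sub>R u)) (a *\<^sub>R u)" using near_zero[of "a *\<^sub>R u"] \<open>a > 0\<close> assms by simp
  then have fa: "0 < ?f a" using \<open>a > 0\<close> by (simp add: blinfun.scaleR_right zero_less_mult_iff)
  obtain t where t: "t > 0" "\<Phi> (t *\<^sub>R u) < 0" using far[OF assms] by blast
  obtain z where z: "0 < z" "z < t" "\<Phi> (t *\<^sub>R u) - \<Phi> (0 *\<^sub>R u) = (t - 0) * ?f z"
    using MVT2[OF t(1), of "\<lambda>t. \<Phi> (t *\<^sub>R u)" ?f] fiber_DERIV by blast
  then have fz: "?f z < 0" using t zero by (simp add: mult_less_0_iff)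
  have "a < z"
  proof (rule ccontr)
    assume "\<not> a < z"
    moreover have "z \<noteq> a" using fa fz by auto
    ultimately have "?f a < 0" using fiber_sign_transfer(2)[OF assms z(1), of a] fz by simp
    then show False using fa by simp
  qed
  moreover have "continuous_on {a..z} ?f"
    unfolding continuous_on_def by (intro ballI tendsto_intros)
  ultimately obtain s where "a \<le> s" "s \<le> z" "?f s = 0"
    using IVT2'[of ?f z 0 a] fa fz by auto
  then show ?thesis using \<open>a > 0\<close> by (intro exI[of _ s]) auto
qed

definition \<tau> :: "'a \<Rightarrow> real" where
  "\<tau> u = (SOME t. t > 0 \<and> blinfun_apply (\<Phi>' (t *\<^sub>R u)) u = 0)"

lemma \<tau>: assumes "u \<noteq> 0" shows "\<tau> u > 0" "blinfun_apply (\<Phi>' (\<tau> u *\<^sub>R u)) u = 0"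
  using someI_ex[of "\<lambda>t. t > 0 \<and> blinfun_apply (\<Phi>' (t *\<^sub>R u)) u = 0"] fiber_zero_exists[OF assms]
  unfolding \<tau>_def by blast+

lemma before_\<tau>: "u \<noteq> 0 \<Longrightarrow> 0 < s \<Longrightarrow> s < \<tau> u \<Longrightarrow> 0 < blinfun_apply (\<Phi>' (s *\<^sub>R u)) u"
  using fiber_sign_transfer(1)[of u s "\<tau> u"] \<tau>(2)[of u] by simp

lemma after_\<tau>: "u \<noteq> 0 \<Longrightarrow> \<tau> u < s \<Longrightarrow> blinfun_apply (\<Phi>' (s *\<^sub>R u)) u < 0"
  using fiber_sign_transfer(2)[of u "\<tau> u" s] \<tau>[of u] by simp

lemma \<tau>_eqI: "u \<noteq> 0 \<Longrightarrow> 0 < t \<Longrightarrow> blinfun_apply (\<Phi>' (t *\<^sub>R u)) u = 0 \<Longrightarrow> \<tau> u = t"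
  using before_\<tau>[of u t] after_\<tau>[of u t] by (metis less_irrefl linorder_neqE_linordered_idom)

lemma \<tau>_scale: "u \<noteq> 0 \<Longrightarrow> s > 0 \<Longrightarrow> \<tau> (s *\<^sub>R u) = \<tau> u / s"
  by (rule \<tau>_eqI) (simp_all add: \<tau> blinfun.scaleR_right)

lemma \<tau>_minus: "u \<noteq> 0 \<Longrightarrow> \<tau> (- u) = \<tau> u"
  by (rule \<tau>_eqI) (simp_all add: \<tau> odd blinfun.minus_left blinfun.minus_right)

lemma \<tau>_lower: assumes "norm u = 1" shows "\<rho> \<le> \<tau> u"
proof (rule ccontr)
  assume "\<not> \<rho> \<le> \<tau> u"
  have "u \<noteq> 0" using assms by auto
  then have "0 < blinfun_apply (\<Phi>' (\<tau> u *\<^sub>R u)) (\<tau> u *\<^sub>R u)"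
    using near_zero[of "\<tau> u *\<^sub>R u"] \<tau>(1)[of u] \<open>\<not> \<rho> \<le> \<tau> u\<close> assms by simp
  then show False using \<tau>[OF \<open>u \<noteq> 0\<close>] by (simp add: blinfun.scaleR_right)
qed

lemma fiber_max:
  assumes "u \<noteq> 0" "s > 0"
  shows "\<Phi> (s *\<^sub>R u) \<le> \<Phi> (\<tau> u *\<^sub>R u)"
proof (cases "s \<le> \<tau> u")
  case True
  have "0 \<le> blinfun_apply (\<Phi>' (x *\<^sub>R u)) u" if "s \<le> x" "x \<le> \<tau> u" for x
    using before_\<tau>[OF assms(1), of x] \<tau>(2)[OF assms(1)] that assms(2) by (cases "x = \<tau> u") auto
  then show ?thesis
    using DERIV_nonneg_imp_nondecreasing[OF True, of "\<lambda>t. \<Phi> (t *\<^sub>R u)"] fiber_DERIV by blast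
next
  case False
  have "blinfun_apply (\<Phi>' (x *\<^sub>R u)) u \<le> 0" if "\<tau> u \<le> x" for x
    using after_\<tau>[OF assms(1), of x] \<tau>(2)[OF assms(1)] that by (cases "x = \<tau> u") auto
  then show ?thesis
    using DERIV_nonpos_imp_nonincreasing[of "\<tau> u" s "\<lambda>t. \<Phi> (t *\<^sub>R u)"] fiber_DERIV False by force
qed

text \<open>
  The inequalities \<open>s < \<tau> y\<close> and \<open>\<tau> y < s\<close> are equivalent to sign conditions on
  \<open>\<Phi>' (s *\<^sub>R y) y\<close>, which are open in \<open>y\<close>.
\<close>
lemma tendsto_\<tau>_at:
  assumes "u \<noteq> 0"
  shows "(\<tau> \<longlongrightarrow> \<tau> u) (at u)"
proof (rule order_tendstoI)
  have ev0: "\<forall>\<^sub>F y in at u. y \<noteq> 0"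
    using assms by (intro tendsto_imp_eventually_ne[OF tendsto_ident_at])
  fix a assume "a < \<tau> u"
  define s where "s = max (\<tau> u / 2) ((a + \<tau> u) / 2)"
  have s: "0 < s" "s < \<tau> u" "a < s" using \<tau>(1)[OF assms] \<open>a < \<tau> u\<close> unfolding s_def by (simp_all add: less_max_iff_disj)
  have "((\<lambda>y. blinfun_apply (\<Phi>' (s *\<^sub>R y)) y) \<longlongrightarrow> blinfun_apply (\<Phi>' (s *\<^sub>R u)) u) (at u)"
    by (intro tendsto_intros)
  from order_tendstoD(1)[OF this before_\<tau>[OF assms s(1,2)]] ev0
  show "\<forall>\<^sub>F y in at u. a < \<tau> y"
  proof eventually_elim
    case (elim y)
    have "\<not> \<tau> y < s" using after_\<tau>[of y s] elim by auto
    then show ?case using s(3) by linarith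
  qed
next
  have ev0: "\<forall>\<^sub>F y in at u. y \<noteq> 0"
    using assms by (intro tendsto_imp_eventually_ne[OF tendsto_ident_at])
  fix a assume "\<tau> u < a"
  then have "0 < a" using \<tau>(1)[OF assms] by linarith
  have "((\<lambda>y. blinfun_apply (\<Phi>' (a *\<^sub>R y)) y) \<longlongrightarrow> blinfun_apply (\<Phi>' (a *\<^sub>R u)) u) (at u)"
    by (intro tendsto_intros)
  from order_tendstoD(2)[OF this after_\<tau>[OF assms \<open>\<tau> u < a\<close>]] ev0
  show "\<forall>\<^sub>F y in at u. \<tau> y < a"
  proof eventually_elim
    case (elim y)
    have "\<not> a < \<tau> y" "a \<noteq> \<tau> y" using before_\<tau>[of y a] \<tau>(2)[of y] \<open>0 < a\<close> elim by auto
    then show ?case by linarith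
  qed
qed

lemma tendsto_\<tau> [tendsto_intros]:
  assumes "(X \<longlongrightarrow> x) F" "x \<noteq> 0"
  shows "((\<lambda>n. \<tau> (X n)) \<longlongrightarrow> \<tau> x) F"
  using tendsto_\<tau>_at[OF assms(2)] assms(1) unfolding isCont_def[symmetric] by (rule isCont_tendsto_compose)

definition \<Psi> :: "'a \<Rightarrow> real" where "\<Psi> u = \<Phi> (\<tau> u *\<^sub>R u)"

definition G :: "'a \<Rightarrow> 'a \<Rightarrow>\<^sub>L real" where "G u = \<tau> u *\<^sub>R \<Phi>' (\<tau> u *\<^sub>R u)"

text \<open>
  Since \<open>\<tau> y\<close> maximises \<open>\<Phi>\<close> on the ray through \<open>y\<close>, the increment \<open>\<Psi> y - \<Psi> u\<close> lies between the increment
  of \<open>\<Phi>\<close> from \<open>\<tau> u *\<^sub>R u\<close> to \<open>\<tau> u *\<^sub>R y\<close> and the one from \<open>\<tau> y *\<^sub>R u\<close> to \<open>\<tau> y *\<^sub>R y\<close>. The mean value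
  theorem evaluates both, with \<open>\<tau>\<close> frozen at \<open>\<tau> u\<close> and at \<open>\<tau> y\<close>. So only the continuity of \<open>\<tau>\<close> enters.
\<close>
lemma \<Psi>_has_derivative:
  assumes "u \<noteq> 0"
  shows "(\<Psi> has_derivative blinfun_apply (G u)) (at u)"
  unfolding has_derivative_at_alt
proof (intro conjI allI impI)
  show "bounded_linear (blinfun_apply (G u))" by (rule blinfun.bounded_linear_right)
next
  fix e :: real assume "e > 0"
  define H where "H yz = \<tau> (fst yz) *\<^sub>R \<Phi>' (\<tau> (fst yz) *\<^sub>R snd yz)" for yz
  have "(H \<longlongrightarrow> H (u, u)) (at (u, u))"
    unfolding H_def fst_conv snd_conv using assms
    by (intro tendsto_intros tendsto_eq_intros | simp)+
  then have "\<forall>\<^sub>F yz in at (u, u). dist (H yz) (H (u, u)) < e" using \<open>e > 0\<close> by (rule tendstoD)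
  then obtain d where d: "d > 0" "\<And>yz. yz \<noteq> (u, u) \<Longrightarrow> dist yz (u, u) < d \<Longrightarrow> dist (H yz) (H (u, u)) < e"
    unfolding eventually_at by auto
  have Hu: "H (u, u) = G u" by (simp add: H_def G_def)
  have H: "norm (H (y, z) - G u) \<le> e" if "norm (y - u) < d / 2" "norm (z - u) < d / 2" for y z
  proof (cases "(y, z) = (u, u)")
    case True
    then show ?thesis using Hu \<open>e > 0\<close> by simp
  next
    case False
    have "dist (y, z) (u, u) \<le> dist y u + dist z u"
      unfolding dist_Pair_Pair by (rule sqrt_sum_squares_le_sum) auto
    then have "dist (y, z) (u, u) < d" using that by (simp add: dist_norm)
    then show ?thesis using d(2)[OF False] by (simp add: Hu dist_norm less_imp_le)
  qed
  have "norm (\<Psi> y - \<Psi> u - blinfun_apply (G u) (y - u)) \<le> e * norm (y - u)"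
    if y: "norm (y - u) < min (d / 2) (norm u)" for y
  proof -
    have "y \<noteq> 0" using y by auto
    have along: "\<exists>z. norm (z - u) \<le> norm (y - u) \<and>
        \<Phi> (s *\<^sub>R y) - \<Phi> (s *\<^sub>R u) = blinfun_apply (s *\<^sub>R \<Phi>' (s *\<^sub>R z)) (y - u)" for s
    proof -
      obtain t where t: "t \<in> {0..1}" "\<Phi> (s *\<^sub>R u + s *\<^sub>R (y - u)) - \<Phi> (s *\<^sub>R u)
          = blinfun_apply (\<Phi>' (s *\<^sub>R u + t *\<^sub>R (s *\<^sub>R (y - u)))) (s *\<^sub>R (y - u))"
        using line_mean_value[of \<Phi> \<Phi>' "s *\<^sub>R u" "s *\<^sub>R (y - u)"] deriv by blast
      have "s *\<^sub>R u + t *\<^sub>R (s *\<^sub>R (y - u)) = s *\<^sub>R (u + t *\<^sub>R (y - u))" by (simp add: algebra_simps)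
      moreover have "s *\<^sub>R u + s *\<^sub>R (y - u) = s *\<^sub>R y" by (simp add: algebra_simps)
      moreover have "norm (u + t *\<^sub>R (y - u) - u) \<le> norm (y - u)"
        using t(1) by (simp add: mult_left_le_one_le)
      ultimately show ?thesis using t(2)
        by (intro exI[of _ "u + t *\<^sub>R (y - u)"]) (simp add: blinfun.scaleR_left blinfun.scaleR_right)
    qed
    have bound: "\<bar>blinfun_apply (H (x, z)) (y - u) - blinfun_apply (G u) (y - u)\<bar> \<le> e * norm (y - u)"
      if "norm (x - u) < d / 2" "norm (z - u) < d / 2" for x z
    proof -
      have "\<bar>blinfun_apply (H (x, z) - G u) (y - u)\<bar> \<le> norm (H (x, z) - G u) * norm (y - u)"
        using norm_blinfun[of "H (x, z) - G u" "y - u"] by simp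
      also have "\<dots> \<le> e * norm (y - u)" using H[OF that] by (rule mult_right_mono) simp
      finally show ?thesis by (simp add: blinfun.diff_left)
    qed
    obtain z where z: "norm (z - u) \<le> norm (y - u)"
      "\<Phi> (\<tau> y *\<^sub>R y) - \<Phi> (\<tau> y *\<^sub>R u) = blinfun_apply (H (y, z)) (y - u)"
      using along[of "\<tau> y"] unfolding H_def by auto
    obtain w where w: "norm (w - u) \<le> norm (y - u)"
      "\<Phi> (\<tau> u *\<^sub>R y) - \<Phi> (\<tau> u *\<^sub>R u) = blinfun_apply (H (u, w)) (y - u)"
      using along[of "\<tau> u"] unfolding H_def by auto
    have "\<Psi> y - \<Psi> u \<le> blinfun_apply (H (y, z)) (y - u)"
      using z(2) fiber_max[OF assms \<tau>(1)[OF \<open>y \<noteq> 0\<close>]] by (simp add: \<Psi>_def)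
    moreover have "blinfun_apply (H (u, w)) (y - u) \<le> \<Psi> y - \<Psi> u"
      using w(2) fiber_max[OF \<open>y \<noteq> 0\<close> \<tau>(1)[OF assms]] by (simp add: \<Psi>_def)
    ultimately show ?thesis
      using bound[of y z] bound[of u w] z(1) w(1) y d(1) unfolding real_norm_def by fastforce
  qed
  moreover have "min (d / 2) (norm u) > 0" using d(1) assms by simp
  ultimately show "\<exists>d>0. \<forall>y. norm (y - u) < d \<longrightarrow>
      norm (\<Psi> y - \<Psi> u - blinfun_apply (G u) (y - u)) \<le> e * norm (y - u)" by blast
qed

text \<open>
  The Palais-Smale condition transfers because \<open>\<tau>\<close> is bounded below by \<open>\<rho>\<close> on the unit sphere: this
  makes \<open>\<Phi>' (\<tau> u *\<^sub>R u)\<close> small when \<open>G u\<close> is, and it keeps limits of points of the Nehari set away from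
  \<open>0\<close>, so that they can be projected back to the sphere.
\<close>
lemma reduced_functional: "even_homogeneous_functional \<Psi> G 0"
proof
  show "C1_on (- {0}) \<Psi> G"
    unfolding C1_on_def
  proof
    show "\<forall>x\<in>- {0}. (\<Psi> has_derivative blinfun_apply (G x)) (at x)" using \<Psi>_has_derivative by simp
    show "continuous_on (- {0}) G"
      unfolding continuous_on_def G_def by (auto intro!: tendsto_intros)
  qed
  show "\<Psi> (- u) = \<Psi> u" for u
    using \<tau>_minus[of u] even[of "\<tau> u *\<^sub>R u"] by (cases "u = 0") (simp_all add: \<Psi>_def)
  show "\<Psi> (s *\<^sub>R u) = \<Psi> u" if "s > 0" for s u
    using \<tau>_scale[of u s] that by (cases "u = 0") (simp_all add: \<Psi>_def)
  show "0 \<le> \<Psi> u" if "u \<noteq> 0" for u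
  proof -
    have "(\<lambda>n. \<Phi> (inverse (real (Suc n)) *\<^sub>R u)) \<longlonglongrightarrow> \<Phi> (0 *\<^sub>R u)"
      by (intro tendsto_intros LIMSEQ_inverse_real_of_nat)
    then have "(\<lambda>n. \<Phi> (inverse (real (Suc n)) *\<^sub>R u)) \<longlonglongrightarrow> 0" by (simp add: zero)
    then show ?thesis
      by (rule LIMSEQ_le_const2) (use fiber_max[OF that] in \<open>auto simp: \<Psi>_def\<close>)
  qed
  show "\<exists>\<sigma> l. strict_mono \<sigma> \<and> (\<lambda>n. X (\<sigma> n)) \<longlonglongrightarrow> l"
    if X: "\<And>n. norm (X n) = 1" "(\<lambda>n. \<Psi> (X n)) \<longlonglongrightarrow> c" "(\<lambda>n. G (X n)) \<longlonglongrightarrow> 0" for X c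
  proof -
    have X0: "X n \<noteq> 0" for n using X(1)[of n] by auto
    define m where "m n = \<tau> (X n) *\<^sub>R X n" for n
    have "m n \<in> nehari \<Phi>'" for n
      using \<tau>[OF X0[of n]] X0[of n] by (simp add: nehari_def m_def blinfun.scaleR_right)
    moreover have "bounded (range (\<lambda>n. \<Phi> (m n)))"
      using convergent_imp_bounded[OF X(2)] by (simp add: m_def \<Psi>_def)
    moreover have "(\<lambda>n. \<Phi>' (m n)) \<longlonglongrightarrow> 0"
    proof (rule Lim_null_comparison)
      have "norm (\<Phi>' (m n)) \<le> norm (G (X n)) / \<rho>" for n
      proof -
        have "\<rho> * norm (\<Phi>' (m n)) \<le> \<tau> (X n) * norm (\<Phi>' (m n))"
          using \<tau>_lower[OF X(1)] by (intro mult_right_mono) auto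
        also have "\<dots> = norm (G (X n))" using \<tau>(1)[OF X0[of n]] by (simp add: G_def m_def)
        finally show ?thesis using \<rho> by (simp add: field_simps)
      qed
      then show "\<forall>\<^sub>F n in sequentially. norm (\<Phi>' (m n)) \<le> norm (G (X n)) / \<rho>" by simp
      show "(\<lambda>n. norm (G (X n)) / \<rho>) \<longlonglongrightarrow> 0"
        by (intro tendsto_divide_zero tendsto_norm_zero X(3))
    qed
    ultimately obtain \<sigma> :: "nat \<Rightarrow> nat" where \<sigma>: "strict_mono \<sigma>" "convergent (m \<circ> \<sigma>)"
      using PS unfolding palais_smale_on_def palais_smale_seq_def by blast
    then obtain l where l: "(\<lambda>n. m (\<sigma> n)) \<longlonglongrightarrow> l" unfolding convergent_def by (auto simp: o_def)
    have nm: "norm (m n) = \<tau> (X n)" for n using X(1)[of n] \<tau>(1)[OF X0[of n]] by (simp add: m_def)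
    have "\<rho> \<le> norm l"
      using \<tau>_lower[OF X(1)] by (intro LIMSEQ_le_const[OF tendsto_norm[OF l]]) (simp add: nm)
    then have "l \<noteq> 0" using \<rho> by auto
    have "(\<lambda>n. m (\<sigma> n) /\<^sub>R norm (m (\<sigma> n))) \<longlonglongrightarrow> l /\<^sub>R norm l"
      using \<open>l \<noteq> 0\<close> by (intro tendsto_intros l) simp
    moreover have "m n /\<^sub>R norm (m n) = X n" for n
      unfolding nm using \<tau>(1)[OF X0[of n]] by (simp add: m_def)
    ultimately show ?thesis using \<sigma>(1) by auto
  qed
qed

lemma infinite_critical_points:
  assumes "infinite_dimensional TYPE('a)"
  shows "infinite {u. \<Phi>' u = 0}"
proof
  assume fin: "finite {u. \<Phi>' u = 0}"
  let ?K = "{u. norm u = 1 \<and> G u = 0}"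
  interpret reduced: even_homogeneous_functional \<Psi> G 0 by (rule reduced_functional)
  have nz: "u \<noteq> 0" if "u \<in> ?K" for u using that by auto
  have "(\<lambda>u. \<tau> u *\<^sub>R u) ` ?K \<subseteq> {u. \<Phi>' u = 0}"
    using \<tau>(1)[OF nz] by (fastforce simp: G_def)
  moreover have "inj_on (\<lambda>u. \<tau> u *\<^sub>R u) ?K"
  proof (rule inj_onI)
    fix u v assume uv: "u \<in> ?K" "v \<in> ?K" "\<tau> u *\<^sub>R u = \<tau> v *\<^sub>R v"
    have "norm (\<tau> u *\<^sub>R u) = norm (\<tau> v *\<^sub>R v)" using uv(3) by simp
    then have "\<tau> u = \<tau> v" using uv(1,2) \<tau>(1)[OF nz[OF uv(1)]] \<tau>(1)[OF nz[OF uv(2)]] by simp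
    then show "u = v" using uv(3) \<tau>(1)[OF nz[OF uv(2)]] by simp
  qed
  ultimately have "finite ?K" using fin by (meson finite_imageD finite_subset)
  then show False using reduced.infinite_critical_directions[OF assms] by blast
qed

end

text \<open>
  A singleton is weakly compact, so the uniform decay at infinity makes \<open>\<Phi>\<close> negative somewhere on every ray.
\<close>
theorem corollary1p1:
  fixes \<Phi> :: "'a::banach \<Rightarrow> real"
    and \<Phi>' :: "'a \<Rightarrow> 'a \<Rightarrow>\<^sub>L real"
    and I :: "'a \<Rightarrow> real"
    and p r C\<^sub>0 :: real
  assumes "reflexive_space TYPE('a)"
    and "infinite_dimensional TYPE('a)"
    and "\<exists>N'. C1_on (- {0::'a}) norm N'"
    and "C1_on UNIV \<Phi> \<Phi>'"
    and "\<Phi> 0 = 0"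
    and "p > 1" and "r > 1"
    and "Liminf (at 0) (\<lambda>u. ereal (blinfun_apply (\<Phi>' u) u / norm u powr r)) > 0"
    and "C\<^sub>0 > 0" and "weakly_continuous I"
    and "\<And>u. \<Phi> u \<ge> C\<^sub>0 * norm u powr r - I u"
    and "\<And>K. compactin weak_topology K \<Longrightarrow> K \<subseteq> - {0} \<Longrightarrow>
           \<forall>M::real. \<forall>\<^sub>F t in at_top. \<forall>u\<in>K. \<Phi> (t *\<^sub>R u) / t powr p < M"
    and "\<And>u. u \<noteq> 0 \<Longrightarrow>
           strict_antimono_on {0<..} (\<lambda>t. blinfun_apply (\<Phi>' (t *\<^sub>R u)) u / t powr (p - 1))"
    and "\<And>u. u \<noteq> 0 \<Longrightarrow>
           strict_mono_on {0<..}
             (\<lambda>t. \<Phi> (t *\<^sub>R u) - (1 / p) * blinfun_apply (\<Phi>' (t *\<^sub>R u)) (t *\<^sub>R u))"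
    and "weakly_lsc (\<lambda>u. blinfun_apply (\<Phi>' u) u)"
    and "weakly_lsc (\<lambda>u. \<Phi> u - (1 / p) * blinfun_apply (\<Phi>' u) u)"
    and "\<And>u. \<Phi> (- u) = \<Phi> u"
    and "palais_smale_on (nehari \<Phi>') \<Phi> \<Phi>'"
  shows "infinite (critical_pairs \<Phi>')"
proof
  assume fin: "finite (critical_pairs \<Phi>')"
  have "\<forall>\<^sub>F u in at 0. 0 < ereal (blinfun_apply (\<Phi>' u) u / norm u powr r)"
    using assms(8) by (rule less_LiminfD)
  then obtain \<rho> where \<rho>: "\<rho> > 0" "\<And>u. u \<noteq> 0 \<Longrightarrow> norm u < \<rho> \<Longrightarrow> 0 < blinfun_apply (\<Phi>' u) u / norm u powr r"
    unfolding eventually_at by (auto simp: zero_less_divide_iff)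
  have near: "0 < blinfun_apply (\<Phi>' u) u" if "u \<noteq> 0" "norm u < \<rho>" for u
    using \<rho>(2)[OF that] that(1) by (simp add: zero_less_divide_iff)
  have far: "\<exists>t>0. \<Phi> (t *\<^sub>R u) < 0" if "u \<noteq> 0" for u
  proof -
    have "topspace (weak_topology :: 'a topology) = UNIV"
      unfolding weak_topology_def by (simp add: topspace_pullback_topology)
    then have "compactin weak_topology {u}" by simp
    then have "\<forall>\<^sub>F t in at_top. \<forall>v\<in>{u}. \<Phi> (t *\<^sub>R v) / t powr p < 0"
      using assms(12)[of "{u}"] that by simp
    then have "\<forall>\<^sub>F t in at_top. t > 0 \<and> \<Phi> (t *\<^sub>R u) / t powr p < 0"
      using eventually_gt_at_top[of "0::real"] by eventually_elim simp
    then obtain t where "t > 0" "\<Phi> (t *\<^sub>R u) / t powr p < 0"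
      using eventually_happens'[OF trivial_limit_at_top_linorder] by blast
    then show ?thesis by (intro exI[of _ t]) (simp add: divide_less_0_iff)
  qed
  interpret fibered_functional \<Phi> \<Phi>' p \<rho>
    by unfold_locales (use assms(4,5,13,17,18) \<rho>(1) near far in auto)
  have "{u. \<Phi>' u = 0} \<subseteq> \<Union> (critical_pairs \<Phi>')" unfolding critical_pairs_def by auto
  moreover have "finite (\<Union> (critical_pairs \<Phi>'))"
    using fin by (rule finite_Union) (auto simp: critical_pairs_def)
  ultimately have "finite {u. \<Phi>' u = 0}" by (rule finite_subset)
  then show False using infinite_critical_points[OF assms(2)] by blast
qed

end
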